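(* Let $\Delta_5(n)$ denote the number of broken $5$-diamond partitions of $n$, so that $\sum_{n=0}^{\infty}\Delta_5(n)q^n=\prod_{n=1}^{\infty}\frac{(1-q^{2n})(1-q^{11n})}{(1-q^n)^3(1-q^{22n})}$, and let $E_4(q)=1+240\sum_{n=1}^\infty\big(\sum_{d\mid n}d^3\big)q^n$. Then, as formal power series in $q$ with integer coefficients, $$E_4(q^2)\prod_{n=1}^\infty(1-q^n)^8(1-q^{2n})^2 \equiv 8\sum_{n=0}^\infty \Delta_5(11n+6)q^n \pmod{11}.$$
   Context: For a positive integer $k$, $\Delta_k(n)$ denotes the number of broken $k$-diamond partitions of $n$ (Andrews and Paule). These numbers are integers determined by the generating function identity $$\sum_{n=0}^{\infty}\Delta_k(n)q^n=\prod_{n=1}^{\infty}\frac{(1-q^{2n})(1-q^{(2k+1)n})}{(1-q^n)^3(1-q^{(4k+2)n})},$$ which may be taken as the definition of $\Delta_k(n)$. $E_4$ is the normalized Eisenstein series of weight $4$ for the full modular group $SL_2(\mathbb{Z})$, written as a power series in $q=e^{2\pi i z}$; $E_4(q^2)$ is the series obtained by replacing $q$ by $q^2$ (i.e. $E_4(2z)$), so $E_4(q^2)=1+240\sum_{n=1}^\infty\big(\sum_{d\mid n}d^3\big)q^{2n}$. For power series $f,g\in\mathbb{Z}[[q]]$ and a positive integer $M$, $f\equiv g \pmod M$ means that for every $n\ge 0$ the coefficients of $q^n$ in $f$ and $g$ are congruent modulo $M$. *)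

theory Defs
  imports "HOL-Analysis.Analysis" "HOL-Number_Theory.Cong"
begin

unbundle no vec_syntax
unbundle fps_syntax

text \<open>
  Infinite products in \<open>\<int>[[q]]\<close>, with \<open>fps_X\<close> for \<open>q\<close>, are taken with \<^const>\<open>prodinf\<close> in the
  metric topology of \<^typ>\<open>int fps\<close>, i.e. they are limits of partial products in the
  \<open>q\<close>-adic sense. Products over \<open>n \<ge> 1\<close> are reindexed from \<open>n = 0\<close> using \<open>Suc n\<close>.

  As \<^typ>\<open>int\<close> is not an instance of the class \<^class>\<open>inverse\<close>, division of integer power series is
  not available. The reciprocal of a series \<open>f\<close> with constant coefficient \<open>1\<close> is written
  \<open>fps_right_inverse f 1\<close>, where \<open>1\<close> is the inverse of the constant coefficient.
\<close>

definition broken_diamond_gf :: "nat \<Rightarrow> int fps" where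
  "broken_diamond_gf k =
     (\<Prod>n. (1 - fps_X ^ (2 * Suc n)) * (1 - fps_X ^ ((2 * k + 1) * Suc n)) *
          fps_right_inverse ((1 - fps_X ^ Suc n) ^ 3 * (1 - fps_X ^ ((4 * k + 2) * Suc n))) 1)"

text \<open>
  The number of broken \<open>k\<close>-diamond partitions of \<open>n\<close>, for \<open>k \<ge> 1\<close>, defined by the Andrews--Paule
  generating function.
\<close>
definition broken_diamond :: "nat \<Rightarrow> nat \<Rightarrow> int" where
  "broken_diamond k n = broken_diamond_gf k $ n"

definition eisenstein_E4 :: "int fps" where
  "eisenstein_E4 = Abs_fps (\<lambda>n. if n = 0 then 1 else 240 * (\<Sum>d | d dvd n. int d ^ 3))"

definition fps_cong :: "int fps \<Rightarrow> int fps \<Rightarrow> int \<Rightarrow> bool" where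
  "fps_cong f g M \<longleftrightarrow> (\<forall>n. [f $ n = g $ n] (mod M))"

text \<open>
  The products in question converge, so \<^const>\<open>prodinf\<close> never takes an unspecified value here.
\<close>

lemma fps_has_prod_prodinf:
  fixes f :: "nat \<Rightarrow> int fps"
  assumes f: "\<And>n. fps_cutoff (Suc n) (f n) = 1"
  shows "(\<lambda>m. \<Prod>i\<le>m. f i) \<longlonglongrightarrow> prodinf f" and "f has_prod prodinf f"
proof -
  have nth: "f n $ j = (if j = 0 then 1 else 0)" if "j \<le> n" for n j
    using arg_cong[OF f[of n], of "\<lambda>g. g $ j"] that by (simp split: if_splits)
  have stable: "(\<Prod>i\<le>m + d. f i) $ j = (\<Prod>i\<le>m. f i) $ j" if "j \<le> m" for m d j
  proof (induction d)
    case (Suc d)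
    have "(\<Prod>i\<le>m + Suc d. f i) $ j
        = (\<Sum>a=0..j. (\<Prod>i\<le>m + d. f i) $ a * f (Suc (m + d)) $ (j - a))"
      by (simp add: fps_mult_nth)
    also have "\<dots> = (\<Sum>a=0..j. if a = j then (\<Prod>i\<le>m + d. f i) $ a else 0)"
      using that by (intro sum.cong refl) (auto simp: nth)
    also have "\<dots> = (\<Prod>i\<le>m + d. f i) $ j" by simp
    finally show ?case using Suc by simp
  qed simp
  define p where "p = Abs_fps (\<lambda>j. (\<Prod>i\<le>j. f i) $ j)"
  have lim: "(\<lambda>m. \<Prod>i\<le>m. f i) \<longlonglongrightarrow> p"
  proof (rule tendsto_fpsI)
    fix j
    show "eventually (\<lambda>m. (\<Prod>i\<le>m. f i) $ j = p $ j) sequentially"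
      using eventually_ge_at_top[of j]
    proof eventually_elim
      case (elim m)
      then show ?case using stable[of j j "m - j"] by (simp add: p_def)
    qed
  qed
  have "p $ 0 = 1" by (simp add: p_def nth)
  then have "p \<noteq> 0" by auto
  then have hp: "f has_prod p"
    using lim by (simp add: has_prod_def raw_has_prod_def)
  have f0: "f n \<noteq> 0" for n using nth[of 0 n] by auto
  have uniq: "q = p" if "f has_prod q" for q
  proof -
    have "(\<lambda>m. \<Prod>i\<le>m. f i) \<longlonglongrightarrow> q"
      using that f0 by (simp add: has_prod_def raw_has_prod_def)
    then show ?thesis using lim LIMSEQ_unique by blast
  qed
  have "prodinf f = p"
    unfolding prodinf_def using hp uniq by (rule the_equality)
  then show "(\<lambda>m. \<Prod>i\<le>m. f i) \<longlonglongrightarrow> prodinf f" and "f has_prod prodinf f"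
    using lim hp by simp_all
qed

lemma fps_cutoff_eq_1_iff:
  "fps_cutoff (Suc n) (g :: int fps) = 1 \<longleftrightarrow> (\<exists>h. g = 1 + fps_X ^ Suc n * h)"
proof
  assume g: "fps_cutoff (Suc n) g = 1"
  have "g = fps_cutoff (Suc n) g + fps_X ^ Suc n * fps_shift (Suc n) g"
    by (rule fps_ext) (simp add: fps_X_power_mult_nth del: power_Suc)
  with g show "\<exists>h. g = 1 + fps_X ^ Suc n * h" by metis
next
  assume "\<exists>h. g = 1 + fps_X ^ Suc n * h"
  then obtain h where h: "g = 1 + fps_X ^ Suc n * h" by blast
  show "fps_cutoff (Suc n) g = 1"
    unfolding h by (rule fps_ext) (simp add: fps_X_power_mult_nth del: power_Suc)
qed

lemma fps_cutoff_mult_eq_1: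
  assumes "fps_cutoff (Suc n) (f :: int fps) = 1" "fps_cutoff (Suc n) g = 1"
  shows "fps_cutoff (Suc n) (f * g) = 1"
proof -
  obtain a b where ab: "f = 1 + fps_X ^ Suc n * a" "g = 1 + fps_X ^ Suc n * b"
    using assms unfolding fps_cutoff_eq_1_iff by blast
  have "f * g = 1 + fps_X ^ Suc n * (a + b + fps_X ^ Suc n * a * b)"
    unfolding ab by (simp add: algebra_simps del: power_Suc)
  then show ?thesis unfolding fps_cutoff_eq_1_iff by blast
qed

lemma fps_cutoff_power_eq_1:
  assumes "fps_cutoff (Suc n) (f :: int fps) = 1"
  shows "fps_cutoff (Suc n) (f ^ e) = 1"
proof (induction e)
  case 0
  show ?case unfolding fps_cutoff_eq_1_iff by (rule exI[of _ 0]) simp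
next
  case (Suc e)
  show ?case unfolding power_Suc by (rule fps_cutoff_mult_eq_1[OF assms Suc])
qed

lemma fps_cutoff_right_inverse_eq_1:
  assumes "fps_cutoff (Suc n) (f :: int fps) = 1"
  shows "fps_cutoff (Suc n) (fps_right_inverse f 1) = 1"
proof -
  obtain a where a: "f = 1 + fps_X ^ Suc n * a"
    using assms unfolding fps_cutoff_eq_1_iff by blast
  have "f * fps_right_inverse f 1 = 1"
    by (rule fps_right_inverse) (simp add: a)
  then have "fps_right_inverse f 1 = 1 + fps_X ^ Suc n * (- a * fps_right_inverse f 1)"
    unfolding a by (simp add: algebra_simps del: power_Suc)
  then show ?thesis unfolding fps_cutoff_eq_1_iff by blast
qed

lemma fps_cutoff_one_minus_X_power:
  assumes "c \<ge> 1"
  shows "fps_cutoff (Suc n) (1 - fps_X ^ (c * Suc n) :: int fps) = 1"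
proof -
  obtain d where "c = Suc d" using assms by (cases c) auto
  then have "1 - fps_X ^ (c * Suc n) = 1 + fps_X ^ Suc n * (- (fps_X ^ (d * Suc n)) :: int fps)"
    by (simp only: mult_Suc power_add mult_minus_right diff_conv_add_uminus)
  then show ?thesis unfolding fps_cutoff_eq_1_iff by blast
qed

lemma broken_diamond_gf_has_prod:
  "(\<lambda>n. (1 - fps_X ^ (2 * Suc n)) * (1 - fps_X ^ ((2 * k + 1) * Suc n)) *
        fps_right_inverse ((1 - fps_X ^ Suc n) ^ 3 * (1 - fps_X ^ ((4 * k + 2) * Suc n))) 1)
     has_prod broken_diamond_gf k"
  unfolding broken_diamond_gf_def
  using fps_cutoff_one_minus_X_power[of 1]
  by (intro fps_has_prod_prodinf fps_cutoff_mult_eq_1 fps_cutoff_power_eq_1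
        fps_cutoff_right_inverse_eq_1 fps_cutoff_one_minus_X_power) simp_all

lemma eta_product_has_prod:
  "(\<lambda>n. (1 - fps_X ^ Suc n) ^ a * (1 - fps_X ^ (2 * Suc n)) ^ b) has_prod
     (\<Prod>n. (1 - fps_X ^ Suc n) ^ a * (1 - fps_X ^ (2 * Suc n)) ^ b :: int fps)"
  using fps_cutoff_one_minus_X_power[of 1]
  by (intro fps_has_prod_prodinf fps_cutoff_mult_eq_1 fps_cutoff_power_eq_1
        fps_cutoff_one_minus_X_power) simp_all

end

theory Submission
  imports Defs
begin

text \<open>
  Modulo \<open>11\<close>, the generating function of \<open>\<Delta>\<^sub>5\<close> is, up to a factor in \<open>q\<^sup>1\<^sup>1\<close>, the product
  \<open>\<Prod> (1 - q\<^sup>n)\<^sup>8 (1 - q\<^sup>2\<^sup>n)\<^sup>5\<^sup>6\<close>, which is \<open>q\<^sup>-\<^sup>5 x\<^sup>5 y\<^sup>6 (x - y)\<^sup>5\<close> for \<open>x = \<theta>\<^sub>3\<^sup>4\<close> and \<open>y = \<theta>\<^sub>4\<^sup>4\<close>.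
  The facts needed about \<open>x\<close> and \<open>y\<close> come from the arithmetic-geometric mean: \<open>q \<mapsto> q\<^sup>2\<close> sends
  \<open>a = \<theta>\<^sub>3\<^sup>2\<close> and \<open>b = \<theta>\<^sub>4\<^sup>2\<close> to \<open>(a + b) / 2\<close> and \<open>sqrt (a b)\<close>, and an identity that is compatible
  with this substitution holds as soon as its lowest coefficients agree. This yields
  \<open>q d/dq log (x / y) = x - y\<close>, the differential equation behind \<open>E\<^sub>4(q\<^sup>2) = x\<^sup>2 - x y + y\<^sup>2\<close>, and
  \<open>h(x, y) \<equiv> -1\<close> modulo \<open>11\<close> for the quintic \<open>h\<close> that defines the Hasse invariant.

  Extracting the coefficients with index divisible by \<open>11\<close> is the Cartier operator in the
  coordinate \<open>t = x / y\<close>: after multiplication by \<open>h(x, y)\<^sup>8 \<equiv> 1\<close> the form becomes \<open>(x - y) \<Sum> c\<^sub>k x\<^sup>k y\<^sup>5\<^sup>5\<^sup>-\<^sup>k\<close>,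
  a monomial with \<open>11 \<nmid> k\<close> contributes an exact form and is killed, and one with \<open>k = 11 m\<close> is sent to
  \<open>(x - y) x\<^sup>m y\<^sup>5\<^sup>-\<^sup>m\<close>. The four surviving coefficients \<open>8, -8, 8, 0\<close> are those of \<open>8 x y\<^sup>2 (x\<^sup>2 - x y + y\<^sup>2)\<close>.
\<close>

subsection \<open>Congruences between power series\<close>

text \<open>Divisibility lets one relation serve for both moduli in use: powers of
  \<open>fps_X\<close>, meaning agreement of initial coefficients, and the constant 11.\<close>

definition rcong :: "'a::comm_ring_1 \<Rightarrow> 'a \<Rightarrow> 'a \<Rightarrow> bool" where
  "rcong h f g \<longleftrightarrow> h dvd f - g"

lemma rcong_refl [simp]: "rcong h f f"
  by (simp add: rcong_def)

lemma rcong_sym: "rcong h f g \<Longrightarrow> rcong h g f"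
  unfolding rcong_def by (metis dvd_minus_iff minus_diff_eq)

lemma rcong_trans [trans]: "rcong h f g \<Longrightarrow> rcong h g k \<Longrightarrow> rcong h f k"
  unfolding rcong_def using dvd_add[of h "f - g" "g - k"] by simp

lemma rcong_add: "rcong h f g \<Longrightarrow> rcong h f' g' \<Longrightarrow> rcong h (f + f') (g + g')"
  unfolding rcong_def using dvd_add[of h "f - g" "f' - g'"] by (simp add: algebra_simps)

lemma rcong_mult: "rcong h f g \<Longrightarrow> rcong h f' g' \<Longrightarrow> rcong h (f * f') (g * g')"
  unfolding rcong_def
  using dvd_add[OF dvd_mult2[of h "f - g" f'] dvd_mult[of h "f' - g'" g]]
  by (simp add: algebra_simps)

lemma rcong_uminus: "rcong h f g \<Longrightarrow> rcong h (- f) (- g)"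
  unfolding rcong_def using dvd_minus_iff[of h "f - g"] by (simp del: dvd_minus_iff)

lemma rcong_power: "rcong h f g \<Longrightarrow> rcong h (f ^ n) (g ^ n)"
  by (induction n) (auto intro: rcong_mult)

lemma rcong_sum: "(\<And>i. i \<in> I \<Longrightarrow> rcong h (f i) (g i)) \<Longrightarrow> rcong h (sum f I) (sum g I)"
  by (induction I rule: infinite_finite_induct) (auto intro: rcong_add)

lemma rcong_dvd: "k dvd h \<Longrightarrow> rcong h f g \<Longrightarrow> rcong k f g"
  unfolding rcong_def by (rule dvd_trans)

lemma fps_X_power_dvd_iff: "fps_X ^ n dvd (f :: 'a::comm_ring_1 fps) \<longleftrightarrow> (\<forall>i<n. f $ i = 0)"
proof
  assume "fps_X ^ n dvd f"
  then show "\<forall>i<n. f $ i = 0" by (auto simp: dvd_def fps_X_power_mult_nth)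
next
  assume "\<forall>i<n. f $ i = 0"
  then have "f = fps_X ^ n * fps_shift n f"
    by (intro fps_ext) (auto simp: fps_X_power_mult_nth)
  then show "fps_X ^ n dvd f" by (metis dvd_triv_left)
qed

lemma rcong_fps_X_iff: "rcong (fps_X ^ n) f g \<longleftrightarrow> (\<forall>i<n. f $ i = (g :: 'a::comm_ring_1 fps) $ i)"
  by (simp add: rcong_def fps_X_power_dvd_iff)

lemma fps_eq_if_rcong_X:
  assumes "\<And>n. rcong (fps_X ^ n) f (g :: 'a::comm_ring_1 fps)"
  shows "f = g"
  using assms[of "Suc n" for n] by (auto intro!: fps_ext simp: rcong_fps_X_iff simp del: power_Suc)

text \<open>A factor with nonzero constant term has subdegree 0, so it does not change the order of
  vanishing of \<open>f - g\<close>.\<close>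

lemma rcong_fps_X_cancel:
  assumes "rcong (fps_X ^ n) (u * f) (u * (g :: 'a::idom fps))" "u $ 0 \<noteq> 0"
  shows "rcong (fps_X ^ n) f g"
proof (cases "f = g")
  case False
  have u: "u \<noteq> 0" using assms(2) by auto
  have "fps_X ^ n dvd u * (f - g)" using assms(1) by (simp add: rcong_def algebra_simps)
  then have "n \<le> subdegree (u * (f - g))"
    unfolding fps_X_power_dvd_iff using u False by (intro subdegree_geI) auto
  also have "\<dots> = subdegree (f - g)" using u False assms(2) by simp
  finally have "(f - g) $ i = 0" if "i < n" for i
    using nth_less_subdegree_zero[of i "f - g"] that by linarith
  then show ?thesis
    by (simp add: rcong_def fps_X_power_dvd_iff)
qed simp

lemma of_int_dvd_fps_iff: "(of_int M :: int fps) dvd f \<longleftrightarrow> (\<forall>n. M dvd f $ n)"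
proof
  assume "of_int M dvd f"
  then show "\<forall>n. M dvd f $ n" by (auto simp: dvd_def fps_of_int[symmetric])
next
  assume "\<forall>n. M dvd f $ n"
  then have "f = of_int M * Abs_fps (\<lambda>n. f $ n div M)"
    by (intro fps_ext) (simp add: fps_of_int[symmetric])
  then show "of_int M dvd f" by (metis dvd_triv_left)
qed

lemma fps_cong_iff_rcong: "fps_cong f g M \<longleftrightarrow> rcong (of_int M) f g"
  by (simp add: fps_cong_def rcong_def of_int_dvd_fps_iff cong_iff_dvd_diff)

lemma rcong_int_cancel:
  assumes "rcong (of_int M) (u * f) (u * (g :: int fps))" "u $ 0 = 1"
  shows "rcong (of_int M) f g"
proof -
  have "of_int M dvd fps_right_inverse u 1 * (u * f - u * g)"
    using assms(1) by (simp add: rcong_def)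
  also have "fps_right_inverse u 1 * (u * f - u * g) = (u * fps_right_inverse u 1) * (f - g)"
    by (simp add: algebra_simps)
  also have "u * fps_right_inverse u 1 = 1" by (rule fps_right_inverse) (simp add: assms(2))
  finally show ?thesis by (simp add: rcong_def)
qed

subsection \<open>Dilations and logarithmic derivatives\<close>

abbreviation (input) dil :: "nat \<Rightarrow> int fps \<Rightarrow> int fps" where
  "dil k f \<equiv> f oo fps_X ^ k"

lemma dil_nth: "k > 0 \<Longrightarrow> dil k f $ n = (if k dvd n then f $ (n div k) else 0)"
proof -
  assume k: "k > 0"
  have "dil k f $ n = (\<Sum>i=0..n. f $ i * (if n = k * i then 1 else 0))"
    by (simp add: fps_compose_nth flip: power_mult)
  also have "\<dots> = (\<Sum>i=0..n. if i = n div k then (if k dvd n then f $ i else 0) else 0)"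
    using k by (intro sum.cong refl) auto
  also have "\<dots> = (if k dvd n then f $ (n div k) else 0)" by simp
  finally show ?thesis .
qed

lemma dil_mult: "k > 0 \<Longrightarrow> dil k (f * g) = dil k f * dil k g"
  by (rule fps_compose_mult_distrib) (simp add: fps_X_power_nth)

lemma dil_power: "k > 0 \<Longrightarrow> dil k (f ^ n) = dil k f ^ n"
  by (rule fps_compose_power[symmetric]) simp

lemma dil_numeral [simp]: "dil k (numeral n) = numeral n"
  by (metis fps_const_compose numeral_fps_const)

lemma dil_dil: "j > 0 \<Longrightarrow> k > 0 \<Longrightarrow> dil j (dil k f) = dil (j * k) f"
  by (rule fps_ext) (auto simp: dil_nth div_mult2_eq dvd_div_iff_mult mult.commute
     dest: dvd_mult_left elim!: dvd_mult_imp_div)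

lemma rcong_X_dil:
  assumes "k > 0" "rcong (fps_X ^ n) f g"
  shows "rcong (fps_X ^ (k * n)) (dil k f) (dil k g)"
  using assms by (auto simp: rcong_fps_X_iff dil_nth)

definition qD :: "int fps \<Rightarrow> int fps" where
  "qD f = fps_X * fps_deriv f"

lemma qD_nth: "qD f $ n = int n * f $ n"
  by (cases n) (simp_all add: qD_def)

lemma qD_add: "qD (f + g) = qD f + qD g"
  by (simp add: qD_def algebra_simps)

lemma qD_diff: "qD (f - g) = qD f - qD g"
  by (simp add: qD_def algebra_simps)

lemma qD_mult: "qD (f * g) = qD f * g + f * qD g"
  by (simp add: qD_def algebra_simps)

lemma qD_numeral [simp]: "qD (numeral n) = 0"
  by (simp add: qD_def)

lemma qD_1 [simp]: "qD 1 = 0"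
  by (simp add: qD_def)

lemma qD_dil: "k > 0 \<Longrightarrow> qD (dil k f) = of_nat k * dil k (qD f)"
  by (rule fps_ext) (auto simp: qD_nth dil_nth fps_of_nat[symmetric])

text \<open>The logarithmic derivative \<open>u = qD f / f\<close>, in a form free of
  division.\<close>

definition logD :: "int fps \<Rightarrow> int fps \<Rightarrow> bool" where
  "logD f u \<longleftrightarrow> qD f = f * u"

lemma logD_1: "logD 1 0"
  by (simp add: logD_def)

lemma logD_mult: "logD f u \<Longrightarrow> logD g w \<Longrightarrow> logD (f * g) (u + w)"
  by (simp add: logD_def qD_mult algebra_simps)

lemma logD_power: "logD f u \<Longrightarrow> logD (f ^ n) (of_nat n * u)"
proof (induction n)
  case (Suc n)
  then show ?case using logD_mult[of f u "f ^ n" "of_nat n * u"] by (simp add: algebra_simps)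
qed (simp add: logD_1)

lemma logD_dil: "k > 0 \<Longrightarrow> logD f u \<Longrightarrow> logD (dil k f) (of_nat k * dil k u)"
  by (simp add: logD_def qD_dil dil_mult algebra_simps)

lemma logD_cancel:
  assumes "logD (f * g) w" "logD g u" "g \<noteq> 0"
  shows "logD f (w - u)"
proof -
  have "g * qD f = g * (f * (w - u))"
    using assms(1,2) by (simp add: logD_def qD_mult algebra_simps)
  then show ?thesis using assms(3) by (simp add: logD_def)
qed

lemma logD_unique: "logD f u \<Longrightarrow> logD f w \<Longrightarrow> f \<noteq> 0 \<Longrightarrow> u = w"
  by (simp add: logD_def)

subsection \<open>Theta series and the arithmetic-geometric mean\<close>

text \<open>Counting the integer square roots of \<open>n\<close> encodes Jacobi's theta_3, the sum
  of \<open>q^(i^2)\<close> over all integers \<open>i\<close>; then \<open>fps_alt theta\<close> is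
  theta_4.\<close>

definition theta :: "int fps" where
  "theta = Abs_fps (\<lambda>n. int (card {i::int. i\<^sup>2 = int n}))"

definition fps_alt :: "int fps \<Rightarrow> int fps" where
  "fps_alt f = Abs_fps (\<lambda>n. (- 1) ^ n * f $ n)"

lemma fps_alt_nth [simp]: "fps_alt f $ n = (- 1) ^ n * f $ n"
  by (simp add: fps_alt_def)

lemma fps_alt_mult: "fps_alt (f * g) = fps_alt f * fps_alt g"
proof (rule fps_ext)
  fix n
  have "fps_alt (f * g) $ n = (\<Sum>i=0..n. (- 1) ^ (i + (n - i)) * (f $ i * g $ (n - i)))"
    by (simp add: fps_mult_nth sum_distrib_left)
  also have "\<dots> = (fps_alt f * fps_alt g) $ n"
    unfolding power_add by (simp add: fps_mult_nth algebra_simps)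
  finally show "fps_alt (f * g) $ n = (fps_alt f * fps_alt g) $ n" .
qed

definition reps :: "nat \<Rightarrow> (int \<times> int) set" where
  "reps n = {(i, j). i\<^sup>2 + j\<^sup>2 = int n}"

lemma finite_square_roots: "finite {i::int. i\<^sup>2 = m}"
proof (rule finite_subset)
  show "{i::int. i\<^sup>2 = m} \<subseteq> {-m..m}"
  proof clarsimp
    fix i :: int
    have "\<bar>i\<bar> * 1 \<le> \<bar>i\<bar> * \<bar>i\<bar>" by (cases "i = 0") (simp, intro mult_left_mono, simp_all)
    also have "\<dots> = i\<^sup>2" by (simp add: power2_eq_square)
    finally show "- (i\<^sup>2) \<le> i \<and> i \<le> i\<^sup>2" by linarith
  qed
qed simp

lemma reps_eq: "reps n = (\<Union>k\<le>n. {i. i\<^sup>2 = int k} \<times> {j. j\<^sup>2 = int (n - k)})"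
proof (intro equalityI subsetI)
  fix p assume "p \<in> reps n"
  then obtain i j where p: "p = (i, j)" "i\<^sup>2 + j\<^sup>2 = int n" by (auto simp: reps_def)
  have "nat (i\<^sup>2) \<le> n" "i\<^sup>2 = int (nat (i\<^sup>2))" "j\<^sup>2 = int (n - nat (i\<^sup>2))"
    using p(2) zero_le_power2[of i] zero_le_power2[of j] by linarith+
  then show "p \<in> (\<Union>k\<le>n. {i. i\<^sup>2 = int k} \<times> {j. j\<^sup>2 = int (n - k)})"
    unfolding p(1) by blast
qed (auto simp: reps_def)

lemma sum_reps:
  fixes g :: "int \<Rightarrow> int \<Rightarrow> int"
  shows "(\<Sum>(i, j)\<in>reps n. g i j)
    = (\<Sum>k=0..n. \<Sum>(i, j)\<in>{i. i\<^sup>2 = int k} \<times> {j. j\<^sup>2 = int (n - k)}. g i j)"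
  unfolding reps_eq
  by (subst sum.UNION_disjoint)
     (auto intro!: finite_cartesian_product finite_square_roots simp: atLeast0AtMost)

lemma minus_one_power_square_root:
  assumes "i\<^sup>2 = int k"
  shows "(- 1) ^ k = (if even i then 1 else - 1 :: int)"
proof -
  have "even k \<longleftrightarrow> even i"
    using arg_cong[OF assms, of even] by simp
  then show ?thesis by simp
qed

lemma theta_square_nth: "(theta ^ 2) $ n = int (card (reps n))"
proof -
  have "int (card (reps n)) = (\<Sum>(i, j)\<in>reps n. 1)" by simp
  also have "\<dots> = (theta ^ 2) $ n"
    unfolding sum_reps power2_eq_square[of theta] fps_mult_nth
    by (intro sum.cong refl) (simp only: theta_def fps_nth_Abs_fps card_cartesian_product
          case_prod_const sum_constant of_nat_mult mult_1_right of_nat_id)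
  finally show ?thesis by simp
qed

lemma theta_mult_alt_nth:
  "(theta * fps_alt theta) $ n = (\<Sum>(i, j)\<in>reps n. if even j then 1 else - 1)"
proof -
  have "(\<Sum>(i, j)\<in>{i. i\<^sup>2 = int k} \<times> {j. j\<^sup>2 = int l}. if even j then 1 else - 1)
      = theta $ k * fps_alt theta $ l" for k l
  proof -
    have "(\<Sum>(i, j)\<in>{i. i\<^sup>2 = int k} \<times> {j::int. j\<^sup>2 = int l}. if even j then 1 else - 1)
      = (\<Sum>(i, j)\<in>{i::int. i\<^sup>2 = int k} \<times> {j::int. j\<^sup>2 = int l}. (- 1) ^ l :: int)"
      by (intro sum.cong refl) (auto simp: minus_one_power_square_root)
    then show ?thesis by (simp add: theta_def card_cartesian_product)
  qed
  then show ?thesis unfolding sum_reps fps_mult_nth by (simp only:)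
qed

text \<open>Up to conjugation this is multiplication by \<open>1 + i\<close> on the Gaussian
  integers, which doubles the norm. It is onto because an even norm forces both coordinates to have
  the same parity.\<close>

lemma reps_double:
  "bij_betw (\<lambda>(u, v). (u + v, u - v)) (reps n) (reps (2 * n))"
proof (rule bij_betw_imageI)
  show "inj_on (\<lambda>(u, v). (u + v, u - v)) (reps n)" by (auto simp: inj_on_def)
  have "p \<in> (\<lambda>(u, v). (u + v, u - v)) ` reps n" if "p \<in> reps (2 * n)" for p
  proof -
    obtain i j where p: "p = (i, j)" "i\<^sup>2 + j\<^sup>2 = 2 * int n" using \<open>p \<in> reps (2 * n)\<close> by (auto simp: reps_def)
    have "even (i\<^sup>2 + j\<^sup>2)" unfolding p(2) by simp
    then have "even (i + j)" by simp
    then obtain u where u: "i + j = 2 * u" by (elim evenE)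
    then have ij: "i = u + (u - j)" "j = u - (u - j)" by simp_all
    have "2 * (u\<^sup>2 + (u - j)\<^sup>2) = i\<^sup>2 + j\<^sup>2"
      by (subst ij(1)) (simp add: power2_eq_square algebra_simps)
    then have "(u, u - j) \<in> reps n" using p(2) by (simp add: reps_def)
    then show ?thesis unfolding p(1) using ij by (intro image_eqI) auto
  qed
  moreover have "(u + v)\<^sup>2 + (u - v)\<^sup>2 = 2 * (u\<^sup>2 + v\<^sup>2)" for u v :: int
    by (simp add: power2_eq_square algebra_simps)
  ultimately show "(\<lambda>(u, v). (u + v, u - v)) ` reps n = reps (2 * n)"
    by (auto simp: reps_def)
qed

text \<open>The arithmetic mean: odd coefficients cancel, even ones double, and
  \<open>reps_double\<close> identifies the representations of \<open>2m\<close> with those of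
  \<open>m\<close>.\<close>

lemma theta_square_dil: "theta ^ 2 + fps_alt theta ^ 2 = 2 * dil 2 (theta ^ 2)"
proof (rule fps_ext)
  fix n
  have alt: "fps_alt theta ^ 2 = fps_alt (theta ^ 2)" by (simp add: power2_eq_square fps_alt_mult)
  show "(theta ^ 2 + fps_alt theta ^ 2) $ n = (2 * dil 2 (theta ^ 2)) $ n"
  proof (cases "even n")
    case True
    then obtain m where n: "n = 2 * m" by (elim evenE)
    then show ?thesis
      unfolding alt using bij_betw_same_card[OF reps_double[of m]]
      by (simp add: dil_nth theta_square_nth numeral_fps_const)
  qed (simp add: alt dil_nth numeral_fps_const)
qed

text \<open>The geometric mean. For even \<open>n\<close>, \<open>reps_double\<close> turns the sign
  into \<open>(-1)^(n/2)\<close>. For odd \<open>n\<close> exactly one coordinate is even, so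
  exchanging the two reverses the sign and the sum vanishes.\<close>

lemma theta_mult_alt: "theta * fps_alt theta = dil 2 (fps_alt theta ^ 2)"
proof (rule fps_ext)
  fix n
  have alt: "fps_alt theta ^ 2 = fps_alt (theta ^ 2)" by (simp add: power2_eq_square fps_alt_mult)
  let ?s = "\<lambda>i::int. if even i then 1 else - 1 :: int"
  show "(theta * fps_alt theta) $ n = dil 2 (fps_alt theta ^ 2) $ n"
  proof (cases "even n")
    case True
    then obtain m where n: "n = 2 * m" by (elim evenE)
    have "(theta * fps_alt theta) $ n = (\<Sum>(u, v)\<in>reps m. ?s (u - v))"
      unfolding theta_mult_alt_nth n
      by (subst sum.reindex_bij_betw[OF reps_double, symmetric]) (simp add: case_prod_unfold)
    also have "\<dots> = (\<Sum>(u, v)\<in>reps m. (- 1) ^ m)"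
    proof (intro sum.cong refl, clarify)
      fix u v assume "(u, v) \<in> reps m"
      then have "even (u\<^sup>2 + v\<^sup>2) \<longleftrightarrow> even m" by (simp add: reps_def)
      then show "?s (u - v) = (- 1) ^ m" by simp
    qed
    finally show ?thesis using n by (simp add: alt dil_nth theta_square_nth)
  next
    case False
    have "(\<Sum>(i, j)\<in>reps n. ?s j) = (\<Sum>(i, j)\<in>reps n. ?s i)"
      by (rule sum.reindex_bij_witness[where i = "\<lambda>(i, j). (j, i)" and j = "\<lambda>(i, j). (j, i)"])
         (auto simp: reps_def)
    moreover have "?s i = - ?s j" if "(i, j) \<in> reps n" for i j
    proof -
      have "odd (i\<^sup>2 + j\<^sup>2)" using that False by (simp add: reps_def)
      then show ?thesis by auto
    qed
    then have "(\<Sum>(i, j)\<in>reps n. ?s i) = (\<Sum>(i, j)\<in>reps n. - ?s j)"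
      by (intro sum.cong refl) (clarify, blast)
    ultimately have "(theta * fps_alt theta) $ n = 0"
      unfolding theta_mult_alt_nth by (simp add: case_prod_unfold sum_negf)
    then show ?thesis using False by (simp add: dil_nth)
  qed
qed

subsection \<open>Gauss's product for the theta series\<close>

text \<open>The q-Pascal rule makes sense in any commutative ring;
  \<open>gauss_binomial_q_fact\<close> recovers the quotient formula in multiplied-out form.\<close>

fun gauss_binomial :: "'a::comm_ring_1 \<Rightarrow> nat \<Rightarrow> nat \<Rightarrow> 'a" where
  "gauss_binomial p n 0 = 1"
| "gauss_binomial p 0 (Suc k) = 0"
| "gauss_binomial p (Suc n) (Suc k) = gauss_binomial p n k + p ^ Suc k * gauss_binomial p n (Suc k)"

definition q_fact :: "'a::comm_ring_1 \<Rightarrow> nat \<Rightarrow> 'a" where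
  "q_fact p n = (\<Prod>i<n. 1 - p ^ Suc i)"

lemma q_fact_0 [simp]: "q_fact p 0 = 1"
  by (simp add: q_fact_def)

lemma q_fact_Suc: "q_fact p (Suc n) = q_fact p n * (1 - p ^ Suc n)"
  by (simp add: q_fact_def)

lemma gauss_binomial_eq_0: "n < k \<Longrightarrow> gauss_binomial p n k = 0"
  by (induction p n k rule: gauss_binomial.induct) auto

text \<open>Splitting off the factor \<open>k = 0\<close> leaves the same product at
  \<open>x * p\<close>, hence the induction for arbitrary \<open>x\<close>. The homogeneous variable
  \<open>y\<close> takes the place of negative powers of \<open>q\<close>.\<close>

lemma q_binomial_theorem:
  "(\<Prod>k<n. y + x * p ^ k)
     = (\<Sum>k\<le>n. gauss_binomial p n k * p ^ (k * (k - 1) div 2) * x ^ k * y ^ (n - k))"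
proof (induction n arbitrary: x)
  case (Suc n)
  let ?t = "\<lambda>x k. gauss_binomial p n k * p ^ (k * (k - 1) div 2) * x ^ k * y ^ (n - k)"
  have ex: "Suc k * (Suc k - 1) div 2 = k * (k - 1) div 2 + k" for k
  proof -
    have "Suc k * (Suc k - 1) = k * (k - 1) + k * 2" by (cases k) simp_all
    then show ?thesis by (metis div_mult_self1 zero_neq_numeral add.commute)
  qed
  have "(\<Prod>k<Suc n. y + x * p ^ k) = (y + x) * (\<Prod>k<n. y + (x * p) * p ^ k)"
    by (subst prod.lessThan_Suc_shift) (simp add: mult.assoc)
  also have "\<dots> = y * (\<Sum>k\<le>n. ?t (x * p) k) + x * (\<Sum>k\<le>n. ?t (x * p) k)"
    unfolding Suc by (simp add: algebra_simps)
  also have "y * (\<Sum>k\<le>n. ?t (x * p) k) = (\<Sum>k\<le>Suc n. ?t (x * p) k * y)"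
    by (simp add: gauss_binomial_eq_0 sum_distrib_left mult_ac)
  also have "\<dots> = y ^ Suc n + (\<Sum>k\<le>n. ?t (x * p) (Suc k) * y)"
    by (subst sum.atMost_Suc_shift) (simp add: mult_ac)
  also have "\<dots> + x * (\<Sum>k\<le>n. ?t (x * p) k)
      = y ^ Suc n + (\<Sum>k\<le>n. ?t (x * p) (Suc k) * y + x * ?t (x * p) k)"
    by (simp add: sum_distrib_left sum.distrib)
  also have "(\<Sum>k\<le>n. ?t (x * p) (Suc k) * y + x * ?t (x * p) k)
    = (\<Sum>k\<le>n. gauss_binomial p (Suc n) (Suc k) * p ^ (Suc k * (Suc k - 1) div 2)
                * x ^ Suc k * y ^ (Suc n - Suc k))"
  proof (intro sum.cong refl)
    fix k assume "k \<in> {..n}"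
    have "gauss_binomial p n (Suc k) * y ^ (n - Suc k) * y = gauss_binomial p n (Suc k) * y ^ (n - k)"
    proof (cases "k = n")
      case False
      with \<open>k \<in> {..n}\<close> have "n - k = Suc (n - Suc k)" by auto
      then show ?thesis by simp
    qed (simp add: gauss_binomial_eq_0)
    moreover have "?t (x * p) (Suc k) * y = (gauss_binomial p n (Suc k) * y ^ (n - Suc k) * y)
        * (p ^ (Suc k * (Suc k - 1) div 2) * (x * p) ^ Suc k)"
      by (simp only: mult_ac)
    ultimately have "?t (x * p) (Suc k) * y = (gauss_binomial p n (Suc k) * y ^ (n - k))
        * (p ^ (Suc k * (Suc k - 1) div 2) * (x * p) ^ Suc k)"
      by (simp only:)
    then show "?t (x * p) (Suc k) * y + x * ?t (x * p) k = gauss_binomial p (Suc n) (Suc k)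
        * p ^ (Suc k * (Suc k - 1) div 2) * x ^ Suc k * y ^ (Suc n - Suc k)"
      unfolding ex by (simp add: power_add power_mult_distrib algebra_simps)
  qed
  also have "y ^ Suc n + \<dots> = (\<Sum>k\<le>Suc n. gauss_binomial p (Suc n) k * p ^ (k * (k - 1) div 2)
                * x ^ k * y ^ (Suc n - k))"
    by (simp only: sum.atMost_Suc_shift) simp
  finally show ?case .
qed simp

text \<open>The Pascal rule matches the splitting
  \<open>1 - p^(n+1) = (1 - p^(k+1)) + p^(k+1) (1 - p^(n-k))\<close>.\<close>

lemma gauss_binomial_q_fact:
  "k \<le> n \<Longrightarrow> gauss_binomial p n k * q_fact p k * q_fact p (n - k) = q_fact p n"
proof (induction p n k rule: gauss_binomial.induct)
  case (3 p n k)
  show ?case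
  proof (cases "k = n")
    case False
    with 3 have "n - k = Suc (n - Suc k)" "Suc k \<le> n" by auto
    note IH = 3(1)[of] 3(2)[OF this(2)]
    have "k + Suc (n - Suc k) = n" using \<open>Suc k \<le> n\<close> by simp
    then have pn: "p ^ Suc n = p ^ Suc k * p ^ Suc (n - Suc k)"
      by (metis add_Suc power_add)
    have "gauss_binomial p (Suc n) (Suc k) * q_fact p (Suc k) * q_fact p (Suc n - Suc k)
      = (gauss_binomial p n k * q_fact p k * q_fact p (n - k)) * (1 - p ^ Suc k)
        + p ^ Suc k * (1 - p ^ Suc (n - Suc k)) *
          (gauss_binomial p n (Suc k) * q_fact p (Suc k) * q_fact p (n - Suc k))"
      by (simp add: q_fact_Suc \<open>n - k = Suc (n - Suc k)\<close> algebra_simps del: power_Suc)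
    also have "\<dots> = q_fact p n * (1 - p ^ Suc n)"
      using 3 \<open>Suc k \<le> n\<close> unfolding pn by (simp add: algebra_simps del: power_Suc)
    finally show ?thesis by (simp add: q_fact_Suc)
  next
    case True
    then have "gauss_binomial p n n * q_fact p n = q_fact p n" using 3(1) by simp
    then have "gauss_binomial p n n * (q_fact p n * c) = q_fact p n * c" for c
      by (metis mult.assoc)
    then show ?thesis unfolding \<open>k = n\<close> by (simp add: gauss_binomial_eq_0 q_fact_Suc)
  qed
qed simp_all

lemma rcong_scale: "rcong h f g \<Longrightarrow> rcong (c * h) (c * f) (c * g)"
  unfolding rcong_def by (metis dvd_refl mult_dvd_mono right_diff_distrib)

section \<open>The Euler product and its logarithmic derivative\<close>

definition euler :: "int fps" where
  "euler = Abs_fps (\<lambda>n. q_fact fps_X n $ n)"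

text \<open>Each further factor is congruent to 1, so the coefficients up to index \<open>n\<close>
  are final. This justifies the diagonal definition of \<open>euler\<close>.\<close>

lemma q_fact_X_stable:
  assumes "n \<le> m"
  shows "rcong (fps_X ^ Suc n) (q_fact fps_X m) (q_fact fps_X n :: int fps)"
  using assms
proof (induction m rule: dec_induct)
  case (step m)
  have "rcong (fps_X ^ Suc m) (1 - fps_X ^ Suc m) (1 :: int fps)"
    by (simp add: rcong_def del: power_Suc)
  then have "rcong (fps_X ^ Suc n) (1 - fps_X ^ Suc m) (1 :: int fps)"
    by (rule rcong_dvd[rotated]) (use step in \<open>auto intro: le_imp_power_dvd simp del: power_Suc\<close>)
  from rcong_mult[OF step.IH this] show ?case by (simp add: q_fact_Suc)
qed simp

lemma rcong_euler: "rcong (fps_X ^ Suc n) euler (q_fact fps_X n)"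
  unfolding rcong_fps_X_iff
proof (intro allI impI)
  fix i assume "i < Suc n"
  then show "euler $ i = q_fact fps_X n $ i"
    using q_fact_X_stable[of i n] by (simp add: euler_def rcong_fps_X_iff del: power_Suc)
qed

lemma euler_nth_0 [simp]: "euler $ 0 = 1"
  by (simp add: euler_def)

lemma dil_nth_0 [simp]: "k > 0 \<Longrightarrow> dil k f $ 0 = f $ 0"
  by (simp add: dil_nth)

lemma dil_eq_0_iff [simp]: "k > 0 \<Longrightarrow> dil k f = 0 \<longleftrightarrow> f = 0"
  by (subst fps_compose_eq_0_iff) auto

lemma euler_nonzero [simp]: "euler \<noteq> 0"
  using euler_nth_0 by (metis fps_zero_nth zero_neq_one)

lemma dil_q_fact: "k > 0 \<Longrightarrow> dil k (q_fact fps_X n) = q_fact (fps_X ^ k) n"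
proof (induction n)
  case (Suc n)
  have "dil k (1 - fps_X ^ Suc n) = 1 - (fps_X ^ k) ^ Suc n"
    using Suc.prems
    by (simp add: fps_compose_sub_distrib dil_power del: power_Suc) 
  then show ?case using Suc by (simp only: q_fact_Suc dil_mult)
qed simp

lemma rcong_dil_euler:
  assumes "k > 0"
  shows "rcong (fps_X ^ (k * Suc n)) (dil k euler) (q_fact (fps_X ^ k) n)"
  using rcong_X_dil[OF assms rcong_euler[of n]] by (simp add: dil_q_fact assms)

definition sigma_gf :: "int fps" where
  "sigma_gf = Abs_fps (\<lambda>n. if n = 0 then 0 else \<Sum>d | d dvd n. int d)"

text \<open>The geometric series \<open>L = i (q^i + q^(2i) + ...)\<close> enters through its
  recursion \<open>L = q^i L + i q^i\<close>, which replaces division by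
  \<open>1 - q^i\<close>.\<close>

lemma logD_one_minus_X_power:
  assumes "i > 0"
  shows "logD (1 - fps_X ^ i) (- Abs_fps (\<lambda>m. if m > 0 \<and> i dvd m then int i else 0))"
proof -
  define L where "L = Abs_fps (\<lambda>m. if m > 0 \<and> i dvd m then int i else 0)"
  have "fps_X ^ i * L + of_nat i * fps_X ^ i = L"
    using assms unfolding L_def
    by (intro fps_ext)
       (auto simp: fps_X_power_mult_nth fps_X_power_nth fps_of_nat[symmetric] dvd_imp_le dvd_minus_self not_less)
  moreover have "qD (fps_X ^ i) = of_nat i * fps_X ^ i"
    by (intro fps_ext) (auto simp: qD_nth fps_of_nat[symmetric])
  ultimately show ?thesis
    unfolding L_def[symmetric] by (simp add: logD_def qD_diff algebra_simps)
qed

lemma logD_q_fact: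
  "logD (q_fact fps_X n) (- (\<Sum>i<n. Abs_fps (\<lambda>m. if m > 0 \<and> Suc i dvd m then int (Suc i) else 0)))"
proof (induction n)
  case (Suc n)
  from logD_mult[OF Suc logD_one_minus_X_power[of "Suc n"]] show ?case
    by (simp add: q_fact_Suc del: power_Suc)
qed (simp add: logD_1)

text \<open>Adding the series of the single factors collects at index \<open>m\<close> the divisors
  of \<open>m\<close>; those up to \<open>n\<close> suffice when \<open>m\<close> is at most
  \<open>n\<close>.\<close>

lemma logD_euler: "logD euler (- sigma_gf)"
  unfolding logD_def
proof (rule fps_eq_if_rcong_X)
  fix n
  define T where "T = (\<Sum>i<n. Abs_fps (\<lambda>m. if m > 0 \<and> Suc i dvd m then int (Suc i) else 0))"
  have "T $ m = sigma_gf $ m" if "m < Suc n" for m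
  proof (cases "m = 0")
    case False
    have "T $ m = (\<Sum>i<n. if Suc i dvd m then int (Suc i) else 0)"
      using False by (simp add: T_def fps_sum_nth)
    also have "\<dots> = (\<Sum>d\<in>Suc ` {..<n}. if d dvd m then int d else 0)"
      by (subst sum.reindex) auto
    also have "\<dots> = (\<Sum>d | d dvd m. int d)"
    proof (rule sum.mono_neutral_cong_right)
      show "{d. d dvd m} \<subseteq> Suc ` {..<n}"
      proof
        fix d assume "d \<in> {d. d dvd m}"
        with False that have "0 < d" "d \<le> n" using dvd_imp_le[of d m] by (auto intro: Nat.gr0I)
        then show "d \<in> Suc ` {..<n}" by (intro image_eqI[of _ _ "d - 1"]) auto
      qed
    qed auto
    finally show ?thesis using False by (simp add: sigma_gf_def)
  qed (simp add: T_def sigma_gf_def fps_sum_nth)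
  then have "rcong (fps_X ^ Suc n) T sigma_gf" unfolding rcong_fps_X_iff by blast
  then have "rcong (fps_X ^ Suc n) (q_fact fps_X n * - T) (euler * - sigma_gf)"
    by (intro rcong_mult rcong_uminus rcong_sym[OF rcong_euler])
  moreover have "rcong (fps_X ^ Suc n) (qD euler) (qD (q_fact fps_X n))"
    using rcong_euler[of n] by (simp add: rcong_fps_X_iff qD_nth del: power_Suc)
  moreover have "qD (q_fact fps_X n) = q_fact fps_X n * - T"
    using logD_q_fact[of n] by (simp add: logD_def T_def)
  ultimately have "rcong (fps_X ^ Suc n) (qD euler) (euler * - sigma_gf)"
    by (metis rcong_trans)
  then show "rcong (fps_X ^ n) (qD euler) (euler * - sigma_gf)"
    by (rule rcong_dvd[rotated]) simp
qed

section \<open>The finite form of Gauss's identity and its limit\<close>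

definition odd_fact :: "nat \<Rightarrow> int fps" where
  "odd_fact n = (\<Prod>i<n. 1 - fps_X ^ (2 * i + 1))"

lemma odd_fact_mult: "odd_fact n * q_fact (fps_X ^ 2) n = q_fact fps_X (2 * n)"
proof (induction n)
  case (Suc n)
  have "q_fact fps_X (2 * Suc n)
      = q_fact fps_X (2 * n) * (1 - fps_X ^ (2 * n + 1)) * (1 - fps_X ^ (2 * Suc n) :: int fps)"
    using q_fact_Suc[of "fps_X :: int fps" "2 * n + 1"] q_fact_Suc[of "fps_X :: int fps" "2 * n"]
    by (simp del: power_Suc)
  also have "\<dots> = (odd_fact n * (1 - fps_X ^ (2 * n + 1)))
      * (q_fact (fps_X ^ 2) n * (1 - (fps_X ^ 2) ^ Suc n))"
    unfolding Suc[symmetric] power_mult[of _ 2 "Suc n"] by (simp only: mult_ac)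
  also have "odd_fact n * (1 - fps_X ^ (2 * n + 1)) = odd_fact (Suc n)"
    by (simp add: odd_fact_def)
  finally show ?case unfolding q_fact_Suc by (rule sym)
qed (simp add: odd_fact_def)

lemma prod_split_half:
  fixes g :: "nat \<Rightarrow> 'a::comm_monoid_mult"
  shows "(\<Prod>k<2 * n. g k) = (\<Prod>k<n. g (n - Suc k)) * (\<Prod>k<n. g (n + k))"
proof -
  have "(\<Prod>k<2 * n. g k) = (\<Prod>k<n. g k) * (\<Prod>k=n..<n+n. g k)"
    by (simp add: prod.atLeastLessThan_concat lessThan_atLeast0 mult_2)
  also have "(\<Prod>k=n..<n+n. g k) = (\<Prod>k<n. g (n + k))"
    using prod.shift_bounds_nat_ivl[of g 0 n n] by (simp add: lessThan_atLeast0 add.commute)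
  finally show ?thesis by (simp add: prod.nat_diff_reindex)
qed

text \<open>The \<open>q\<close>-binomial theorem for \<open>q\<^sup>2\<close> at \<open>x = -1\<close>, \<open>y = q\<^sup>2\<^sup>n\<^sup>-\<^sup>1\<close>; both sides carry the
  factor \<open>q ^ (3n\<^sup>2 - 2n)\<close>.\<close>

lemma odd_fact_square:
  "(odd_fact n) ^ 2 = (\<Sum>k\<le>2 * n. gauss_binomial (fps_X ^ 2) (2 * n) k
      * (- 1) ^ (n + k) * fps_X ^ nat ((int k - int n)\<^sup>2))"
proof (cases n)
  case (Suc m)
  define p y :: "int fps" where "p = fps_X ^ 2" and "y = fps_X ^ (2 * m + 1)"
  \<comment> \<open>The factors with indices \<open>n - 1 - k\<close> and \<open>n + k\<close> both
    reduce to \<open>1 - q^(2k+1)\<close>. The first kind contributes the power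
    \<open>n (n - 1)\<close> of \<open>q\<close>, the second \<open>(2m + 1) n\<close>.\<close>
  define C where "C = n * (n - 1) + (2 * m + 1) * n"
  have lo: "y + (- 1) * p ^ (n - Suc k) = - (p ^ (n - Suc k)) * (1 - fps_X ^ (2 * k + 1))"
    if "k < n" for k
  proof -
    have "2 * m + 1 = 2 * (n - Suc k) + (2 * k + 1)" using that Suc by simp
    then have "y = p ^ (n - Suc k) * fps_X ^ (2 * k + 1)"
      unfolding y_def p_def power_mult[symmetric] power_add[symmetric] by simp
    then show ?thesis by (simp add: algebra_simps)
  qed
  have hi: "y + (- 1) * p ^ (n + k) = y * (1 - fps_X ^ (2 * k + 1))" for k
  proof -
    have "2 * (n + k) = (2 * m + 1) + (2 * k + 1)" using Suc by simp
    then have "p ^ (n + k) = y * fps_X ^ (2 * k + 1)"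
      unfolding y_def p_def power_mult[symmetric] power_add[symmetric] by simp
    then show ?thesis by (simp add: algebra_simps)
  qed
  have pprod: "(\<Prod>k<n. p ^ (n - Suc k)) = fps_X ^ (n * (n - 1))"
  proof -
    have "(\<Prod>k<n. p ^ (n - Suc k)) = (\<Prod>k<n. p ^ k)" by (rule prod.nat_diff_reindex)
    also have "\<dots> = fps_X ^ (n * (n - 1))"
      unfolding p_def
    proof (induction n)
      case (Suc n)
      have "n * (n - 1) + 2 * n = Suc n * (Suc n - 1)" by (cases n) simp_all
      then show ?case using Suc by (simp flip: power_mult power_add)
    qed simp
    finally show ?thesis .
  qed
  have "(\<Prod>k<2 * n. y + (- 1) * p ^ k)
      = (\<Prod>k<n. - (p ^ (n - Suc k)) * (1 - fps_X ^ (2 * k + 1)))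
        * (\<Prod>k<n. y * (1 - fps_X ^ (2 * k + 1)))"
    unfolding prod_split_half hi by (intro arg_cong2[of _ _ _ _ "(*)"] prod.cong refl lo) simp
  also have "(\<Prod>k<n. - (p ^ (n - Suc k)) * (1 - fps_X ^ (2 * k + 1)))
      = (- 1) ^ n * fps_X ^ (n * (n - 1)) * odd_fact n"
    unfolding odd_fact_def pprod[symmetric] prod.distrib[symmetric]
    by (simp add: prod.distrib prod_uminus)
  also have "(\<Prod>k<n. y * (1 - fps_X ^ (2 * k + 1))) = fps_X ^ ((2 * m + 1) * n) * odd_fact n"
    unfolding odd_fact_def y_def by (simp only: prod.distrib prod_constant card_lessThan power_mult)
  finally have L: "(\<Prod>k<2 * n. y + (- 1) * p ^ k) = fps_X ^ C * ((- 1) ^ n * odd_fact n ^ 2)"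
    unfolding C_def by (simp only: power2_eq_square power_add mult_ac)
  have R: "gauss_binomial p (2 * n) k * p ^ (k * (k - 1) div 2) * (- 1) ^ k * y ^ (2 * n - k)
      = fps_X ^ C * (gauss_binomial p (2 * n) k * (- 1) ^ k * fps_X ^ nat ((int k - int n)\<^sup>2))"
    if "k \<le> 2 * n" for k
  proof -
    have ev: "2 * (k * (k - 1) div 2) = k * (k - 1)" by (cases "even k") auto
    \<comment> \<open>Completing the square: the exponent of \<open>q\<close> is \<open>C\<close>
      plus \<open>(k - n)^2\<close>.\<close>
    have "int (k * (k - 1) + (2 * m + 1) * (2 * n - k)) = int (C + nat ((int k - int n)\<^sup>2))"
    proof -
      have k: "int (k * (k - 1)) = int k * (int k - 1)" by (cases k) (simp_all add: algebra_simps)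
      have n: "int (n * (n - 1)) = int n * (int n - 1)" using Suc by (simp add: algebra_simps)
      have m: "int m = int n - 1" using Suc by simp
      have d: "int (2 * n - k) = 2 * int n - int k" using that by simp
      have e: "int (nat ((int k - int n)\<^sup>2)) = (int k - int n)\<^sup>2" by simp
      show ?thesis
        unfolding C_def of_nat_add of_nat_mult[of "2 * m + 1"] k n d e
        by (simp add: m power2_eq_square algebra_simps)
    qed
    then have "k * (k - 1) + (2 * m + 1) * (2 * n - k) = C + nat ((int k - int n)\<^sup>2)"
      by (simp only: of_nat_eq_iff)
    moreover have "p ^ (k * (k - 1) div 2) * y ^ (2 * n - k)
        = fps_X ^ (k * (k - 1) + (2 * m + 1) * (2 * n - k))"
      by (simp only: p_def y_def power_mult[symmetric] ev power_add[symmetric])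
    ultimately have "p ^ (k * (k - 1) div 2) * y ^ (2 * n - k)
        = fps_X ^ C * fps_X ^ nat ((int k - int n)\<^sup>2)"
      by (simp only: power_add)
    then show ?thesis by (simp add: mult_ac)
  qed
  have "fps_X ^ C * ((- 1) ^ n * odd_fact n ^ 2) = fps_X ^ C * (\<Sum>k\<le>2 * n.
      gauss_binomial p (2 * n) k * (- 1) ^ k * fps_X ^ nat ((int k - int n)\<^sup>2))"
    unfolding L[symmetric] q_binomial_theorem sum_distrib_left
    by (intro sum.cong refl R) simp
  then have "(- 1) ^ n * odd_fact n ^ 2 = (\<Sum>k\<le>2 * n.
      gauss_binomial p (2 * n) k * (- 1) ^ k * fps_X ^ nat ((int k - int n)\<^sup>2))"
    by simp
  then have "(- 1) ^ n * ((- 1) ^ n * odd_fact n ^ 2) = (\<Sum>k\<le>2 * n.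
      gauss_binomial p (2 * n) k * (- 1) ^ (n + k) * fps_X ^ nat ((int k - int n)\<^sup>2))"
    by (simp add: sum_distrib_left power_add mult_ac)
  then show ?thesis unfolding p_def by (simp flip: mult.assoc power_mult_distrib)
qed (simp add: odd_fact_def)

text \<open>With \<open>j = k - n\<close> this is the sum of \<open>(-1)^j q^(j^2)\<close> over
  \<open>|j| \<le> n\<close>. Every square root of an index up to \<open>2n\<close> lies in that
  range, since \<open>(n + 1)^2 > 2n\<close>.\<close>

lemma alt_theta_truncated:
  "rcong (fps_X ^ (2 * n + 1)) (\<Sum>k\<le>2 * n. (- 1) ^ (n + k) * fps_X ^ nat ((int k - int n)\<^sup>2))
     (fps_alt theta)"
  unfolding rcong_fps_X_iff
proof (intro allI impI)
  fix i assume "i < 2 * n + 1"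
  let ?K = "{k \<in> {..2 * n}. nat ((int k - int n)\<^sup>2) = i}"
  have "(\<Sum>k\<le>2 * n. (- 1) ^ (n + k) * fps_X ^ nat ((int k - int n)\<^sup>2) :: int fps) $ i
      = (\<Sum>k\<le>2 * n. if nat ((int k - int n)\<^sup>2) = i then (- 1) ^ (n + k) else 0)"
  proof -
    have nth: "((- 1) ^ m * fps_X ^ l :: int fps) $ i = (if l = i then (- 1) ^ m else 0)" for m l
      by (cases "even m") (auto simp: fps_X_power_nth)
    show ?thesis unfolding fps_sum_nth by (rule sum.cong[OF refl nth])
  qed
  also have "\<dots> = (\<Sum>k\<in>?K. (- 1) ^ (n + k))"
    by (rule sum.inter_filter[symmetric]) simp
  also have "\<dots> = (\<Sum>k\<in>?K. (- 1) ^ i)"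
  proof (intro sum.cong refl)
    fix k assume "k \<in> ?K"
    then have "nat ((int k - int n)\<^sup>2) = i" by blast
    then have "int i = (int k - int n)\<^sup>2" by (metis int_nat_eq zero_le_power2)
    then have "even (int i) \<longleftrightarrow> even ((int k - int n)\<^sup>2)" by simp
    then have "even i \<longleftrightarrow> even (n + k)" by auto
    then show "(- 1 :: int) ^ (n + k) = (- 1) ^ i" by (simp only: minus_one_power_iff)
  qed
  also have "\<dots> = (- 1) ^ i * int (card ?K)" by simp
  also have "card ?K = card {j::int. j\<^sup>2 = int i}"
  proof (rule bij_betw_same_card, rule bij_betw_imageI)
    show "inj_on (\<lambda>k. int k - int n) ?K" by (auto simp: inj_on_def)
    show "(\<lambda>k. int k - int n) ` ?K = {j. j\<^sup>2 = int i}"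
    proof (intro equalityI subsetI)
      fix j :: int assume "j \<in> {j. j\<^sup>2 = int i}"
      then have j: "j\<^sup>2 = int i" by simp
      have "\<bar>j\<bar> \<le> int n"
      proof (rule ccontr)
        assume "\<not> \<bar>j\<bar> \<le> int n"
        then have "(int n + 1)\<^sup>2 \<le> \<bar>j\<bar>\<^sup>2" by (intro power_mono) auto
        moreover have "(int n + 1)\<^sup>2 = int n * int n + 2 * int n + 1"
          by (simp add: power2_eq_square algebra_simps)
        moreover have "0 \<le> int n * int n" by simp
        ultimately have "2 * int n < int i" unfolding power2_abs j by linarith
        then show False using \<open>i < 2 * n + 1\<close> by simp
      qed
      then show "j \<in> (\<lambda>k. int k - int n) ` ?K"
        using j by (intro image_eqI[of _ _ "nat (j + int n)"]) auto
    qed auto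
  qed
  finally show "(\<Sum>k\<le>2 * n. (- 1) ^ (n + k) * fps_X ^ nat ((int k - int n)\<^sup>2)) $ i
      = fps_alt theta $ i"
    by (simp add: theta_def)
qed

text \<open>All three factorials in \<open>gauss_binomial_q_fact\<close> agree with
  \<open>dil 2 euler\<close> to the stated order, and one copy of it cancels.\<close>

lemma gauss_binomial_limit:
  assumes "k \<le> n"
  shows "rcong (fps_X ^ (2 * Suc (min k (n - k)))) (gauss_binomial (fps_X ^ 2) n k * dil 2 euler) 1"
proof -
  let ?h = "fps_X ^ (2 * Suc (min k (n - k))) :: int fps" and ?e = "dil 2 euler"
  have e: "rcong ?h ?e (q_fact (fps_X ^ 2) l)" if "min k (n - k) \<le> l" for l
    by (rule rcong_dvd[OF _ rcong_dil_euler])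
       (use that in \<open>auto intro!: le_imp_power_dvd simp del: mult_Suc_right power_Suc\<close>)
  have "rcong ?h (gauss_binomial (fps_X ^ 2) n k * ?e * ?e) (gauss_binomial (fps_X ^ 2) n k
      * q_fact (fps_X ^ 2) k * q_fact (fps_X ^ 2) (n - k))"
    by (intro rcong_mult e) auto
  also have "\<dots> = q_fact (fps_X ^ 2) n" by (rule gauss_binomial_q_fact[OF assms])
  also have "rcong ?h (q_fact (fps_X ^ 2) n) ?e"
    using assms by (intro rcong_sym[OF e]) auto
  finally have "rcong ?h (?e * (gauss_binomial (fps_X ^ 2) n k * ?e)) (?e * 1)"
    by (simp add: mult_ac)
  then show ?thesis by (rule rcong_fps_X_cancel) simp
qed

text \<open>Theta_4 is the product of \<open>(1 - q^n)^2 / (1 - q^(2n))\<close>. Multiplying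
  \<open>odd_fact_square\<close> by \<open>dil 2 euler\<close> replaces each Gaussian binomial by 1,
  which leaves the truncated theta series.\<close>

lemma gauss_alt_theta: "fps_alt theta * dil 2 euler = euler ^ 2"
proof (rule fps_eq_if_rcong_X)
  fix n
  let ?h = "fps_X ^ (2 * n + 1) :: int fps" and ?e = "dil 2 euler"
  let ?c = "\<lambda>k. (- 1) ^ (n + k) * fps_X ^ nat ((int k - int n)\<^sup>2) :: int fps"
  have term_cong: "rcong ?h (?c k * (gauss_binomial (fps_X ^ 2) (2 * n) k * ?e)) (?c k * 1)"
    if k: "k \<le> 2 * n" for k
  proof -
    define d s l where "d = \<bar>int k - int n\<bar>" and "s = nat ((int k - int n)\<^sup>2)" and "l = min k (2 * n - k)"
    \<comment> \<open>The error of the binomial at distance \<open>d\<close> from the middle has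
      order \<open>2 (n - d + 1)\<close>. The power \<open>q^(d^2)\<close> raises it to at least
      \<open>2n + 1\<close>, which is exactly this inequality.\<close>
    have "0 \<le> (d - 1)\<^sup>2" by simp
    then have "2 * d \<le> d\<^sup>2 + 1" by (simp add: power2_diff)
    moreover have "int s = d\<^sup>2" by (simp add: s_def d_def)
    moreover have "int l = int n - d" using k by (auto simp: l_def d_def min_def abs_if)
    ultimately have "int (2 * n + 1) \<le> int (s + 2 * Suc l)" by simp
    then have "2 * n + 1 \<le> s + 2 * Suc l" by (simp only: of_nat_le_iff)
    then have "?h dvd ?c k * fps_X ^ (2 * Suc (min k (2 * n - k)))"
      unfolding s_def[symmetric] l_def[symmetric] mult.assoc power_add[symmetric]
      by (intro dvd_mult le_imp_power_dvd)
    then show ?thesis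
      by (rule rcong_dvd) (rule rcong_scale[OF gauss_binomial_limit[OF k]])
  qed
  have "?e * odd_fact n ^ 2
      = (\<Sum>k\<le>2 * n. ?c k * (gauss_binomial (fps_X ^ 2) (2 * n) k * ?e))"
    unfolding odd_fact_square sum_distrib_left by (simp only: mult_ac)
  also have "rcong ?h \<dots> (\<Sum>k\<le>2 * n. ?c k * 1)"
    by (intro rcong_sum term_cong) simp
  also have "rcong ?h (\<Sum>k\<le>2 * n. ?c k * 1) (fps_alt theta)"
    using alt_theta_truncated[of n] by simp
  finally have "rcong ?h (?e * odd_fact n ^ 2) (fps_alt theta)" .
  then have "rcong ?h (fps_alt theta * ?e) ((?e * odd_fact n ^ 2) * ?e)"
    by (rule rcong_mult[OF rcong_sym rcong_refl])
  also have "(?e * odd_fact n ^ 2) * ?e = (odd_fact n * ?e) ^ 2"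
    by (simp add: power2_eq_square mult_ac)
  also have "rcong ?h \<dots> ((odd_fact n * q_fact (fps_X ^ 2) n) ^ 2)"
    by (intro rcong_power rcong_mult rcong_refl rcong_dvd[OF _ rcong_dil_euler] le_imp_power_dvd) auto
  also have "rcong ?h \<dots> (euler ^ 2)"
    unfolding odd_fact_mult using rcong_power[OF rcong_sym[OF rcong_euler[of "2 * n"]]] by simp
  finally show "rcong (fps_X ^ n) (fps_alt theta * ?e) (euler ^ 2)"
    by (rule rcong_dvd[rotated]) (intro le_imp_power_dvd, simp)
qed

subsection \<open>The differential ring of theta series\<close>

text \<open>In terms of the Jacobi theta series, \<open>th_a = \<theta>\<^sub>3\<^sup>2\<close>, \<open>th_b = \<theta>\<^sub>4\<^sup>2\<close> and \<open>th_v = \<theta>\<^sub>2\<^sup>4\<close>.\<close>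

definition th_a :: "int fps" where "th_a = theta ^ 2"
definition th_b :: "int fps" where "th_b = fps_alt theta ^ 2"
definition th_v :: "int fps" where "th_v = th_a ^ 2 - th_b ^ 2"

lemma agm_a: "2 * dil 2 th_a = th_a + th_b"
  unfolding th_a_def th_b_def by (rule theta_square_dil[symmetric])

lemma agm_b: "dil 2 th_b ^ 2 = th_a * th_b"
  unfolding th_a_def th_b_def theta_mult_alt[symmetric] by (simp add: power_mult_distrib)

lemma agm_v: "4 * dil 2 th_v = (th_a - th_b) ^ 2"
proof -
  have "4 * dil 2 th_v = (2 * dil 2 th_a) ^ 2 - 4 * dil 2 th_b ^ 2"
    by (simp add: th_v_def fps_compose_sub_distrib dil_power power_mult_distrib)
  then show ?thesis unfolding agm_a agm_b by (simp add: power2_eq_square algebra_simps)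
qed

lemma theta_nth_0 [simp]: "theta $ 0 = 1"
  by (simp add: theta_def)

lemma theta_nth_1 [simp]: "theta $ Suc 0 = 2"
proof -
  have "{i::int. i\<^sup>2 = 1} = {1, - 1}" by (auto simp: power2_eq_1_iff)
  then show ?thesis by (simp add: theta_def)
qed

lemma th_nth [simp]:
  "th_a $ 0 = 1" "th_b $ 0 = 1" "th_a $ Suc 0 = 4" "th_b $ Suc 0 = - 4" "th_v $ 0 = 0" "th_v $ Suc 0 = 16"
  by (simp_all add: th_v_def th_a_def th_b_def power2_eq_square fps_mult_nth)

lemma th_nonzero [simp]: "th_a \<noteq> 0" "th_b \<noteq> 0" "th_v \<noteq> 0" "th_a + th_b \<noteq> 0"
  using th_nth by (metis fps_zero_nth zero_neq_numeral zero_neq_one,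
    metis fps_zero_nth zero_neq_numeral zero_neq_one,
    metis fps_zero_nth zero_neq_numeral zero_neq_one,
    metis fps_zero_nth fps_add_nth one_add_one zero_neq_numeral)

lemma th_b_eta: "th_b * dil 2 euler ^ 2 = euler ^ 4"
proof -
  have "th_b * dil 2 euler ^ 2 = (fps_alt theta * dil 2 euler) ^ 2"
    by (simp add: th_b_def power_mult_distrib)
  then show ?thesis unfolding gauss_alt_theta by simp
qed

text \<open>By \<open>theta_mult_alt\<close>, theta_3 is \<open>theta_4(q^2)^2 / theta_4(q)\<close>,
  so Gauss's product for theta_4 determines it.\<close>

lemma th_a_eta: "th_a * (euler ^ 4 * dil 4 euler ^ 4) = dil 2 euler ^ 10"
proof -
  have B2: "dil 2 (fps_alt theta) * dil 4 euler = dil 2 euler ^ 2"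
    using arg_cong[OF gauss_alt_theta, of "dil 2"] by (simp add: dil_mult dil_power dil_dil)
  have "theta * euler ^ 2 * dil 4 euler ^ 2
      = (theta * fps_alt theta) * dil 2 euler * dil 4 euler ^ 2"
    unfolding gauss_alt_theta[symmetric] by (simp only: mult_ac)
  also have "\<dots> = dil 2 euler * (dil 2 (fps_alt theta) * dil 4 euler) ^ 2"
    unfolding theta_mult_alt by (simp add: dil_power power_mult_distrib mult_ac)
  also have "\<dots> = dil 2 euler ^ 5"
    unfolding B2 by (simp add: power_mult[symmetric] power_Suc[symmetric] del: power_Suc)
  finally have *: "theta * euler ^ 2 * dil 4 euler ^ 2 = dil 2 euler ^ 5" .
  have "th_a * (euler ^ 4 * dil 4 euler ^ 4) = (theta * euler ^ 2 * dil 4 euler ^ 2) ^ 2"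
    by (simp add: th_a_def power_mult_distrib mult_ac flip: power_mult)
  then show ?thesis unfolding * by (simp flip: power_mult)
qed

text \<open>Both sides solve the functional equation \<open>f(q)\<^sup>2 g(q\<^sup>2) = g(q)\<^sup>2 f(q\<^sup>2)\<close>,
  which propagates the agreement of the leading coefficients.\<close>

lemma th_v_eta: "th_v * dil 2 euler ^ 4 = 16 * fps_X * dil 4 euler ^ 8"
proof (rule ccontr)
  define f g where "f = th_v * dil 2 euler ^ 4" and "g = 16 * fps_X * dil 4 euler ^ 8"
  assume "th_v * dil 2 euler ^ 4 \<noteq> 16 * fps_X * dil 4 euler ^ 8"
  then have d: "f - g \<noteq> 0" by (simp add: f_def g_def)
  have vv: "th_v ^ 2 = 16 * dil 2 th_a ^ 2 * dil 2 th_v"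
  proof -
    have "th_v ^ 2 = (th_a + th_b) ^ 2 * (th_a - th_b) ^ 2"
      by (simp add: th_v_def power2_eq_square algebra_simps)
    then show ?thesis unfolding agm_a[symmetric] agm_v[symmetric]
      by (simp add: power_mult_distrib)
  qed
  have a2: "dil 2 th_a * (dil 2 euler ^ 4 * dil 8 euler ^ 4) = dil 4 euler ^ 10"
    using arg_cong[OF th_a_eta, of "dil 2"] by (simp add: dil_mult dil_power dil_dil)
  have g2: "dil 2 g = 16 * fps_X ^ 2 * dil 8 euler ^ 8"
    by (simp add: g_def dil_mult dil_power dil_dil)
  have f2: "dil 2 f = dil 2 th_v * dil 4 euler ^ 4"
    by (simp add: f_def dil_mult dil_power dil_dil)
  have "f ^ 2 * dil 2 g = 256 * fps_X ^ 2 * dil 2 th_v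
      * (dil 2 th_a * (dil 2 euler ^ 4 * dil 8 euler ^ 4)) ^ 2"
    unfolding g2 f_def power_mult_distrib vv by (simp add: mult_ac flip: power_mult)
  also have "\<dots> = g ^ 2 * dil 2 f"
    unfolding a2 f2 g_def by (simp add: power_mult_distrib mult_ac flip: power_mult power_add)
  finally have "(f - g) * ((f + g) * dil 2 g) = g ^ 2 * dil 2 (f - g)"
    by (simp add: fps_compose_sub_distrib power2_eq_square algebra_simps)
  then have eq: "subdegree ((f - g) * ((f + g) * dil 2 g)) = subdegree (g ^ 2 * dil 2 (f - g))"
    by simp
  have nth: "f $ 0 = 0" "g $ 0 = 0" "f $ 1 = 16" "g $ 1 = 16"
    by (simp_all add: f_def g_def fps_mult_nth_1 mult.assoc numeral_fps_const fps_nth_power_0)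
  have g: "subdegree g = 1" "g \<noteq> 0" and fg: "subdegree (f + g) = 1" "f + g \<noteq> 0"
    using nth by (auto intro!: subdegreeI dest!: arg_cong[of _ _ "\<lambda>h. h $ 1"])
  have "subdegree (f - g) \<ge> 2"
    using d nth by (intro subdegree_geI) (auto simp: less_2_cases_iff)
  \<comment> \<open>For \<open>s\<close> the subdegree of \<open>f - g\<close>, the equation reads
    \<open>s + 3 = 2s + 2\<close>, contradicting \<open>s \<ge> 2\<close>.\<close>
  then show False using eq d g fg by simp
qed

section \<open>Logarithmic derivatives and the Eisenstein series of weight 2\<close>

definition alpha :: "int fps" where
  "alpha = 4 * sigma_gf - 20 * dil 2 sigma_gf + 16 * dil 4 sigma_gf"

definition beta :: "int fps" where
  "beta = 4 * dil 2 sigma_gf - 4 * sigma_gf"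

lemma logD_dil_euler: "k > 0 \<Longrightarrow> logD (dil k euler ^ m) (- (of_nat (m * k) * dil k sigma_gf))"
  using logD_power[OF logD_dil[OF _ logD_euler], of k m]
  by (simp add: fps_compose_uminus mult.assoc)

lemma logD_euler_power: "logD (euler ^ m) (- (of_nat m * sigma_gf))"
  using logD_power[OF logD_euler, of m] by simp

text \<open>\<open>beta\<close> and \<open>alpha\<close> are read off the eta quotients: each factor
  \<open>dil k euler ^ m\<close> contributes \<open>- m k\<close> times
  \<open>dil k sigma_gf\<close>.\<close>

lemma logD_th_b: "logD th_b beta"
proof -
  have "logD (th_b * dil 2 euler ^ 2) (- (4 * sigma_gf))"
    unfolding th_b_eta using logD_euler_power[of 4] by simp
  from logD_cancel[OF this logD_dil_euler] show ?thesis
    by (simp add: beta_def)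
qed

lemma logD_th_a: "logD th_a alpha"
proof -
  have "logD (th_a * (euler ^ 4 * dil 4 euler ^ 4)) (- (20 * dil 2 sigma_gf))"
    unfolding th_a_eta using logD_dil_euler[of 2 10] by simp
  from logD_cancel[OF this logD_mult[OF logD_euler_power logD_dil_euler]] show ?thesis
    by (simp add: alpha_def algebra_simps)
qed

lemma logD_th_v: "logD th_v (1 + 8 * dil 2 sigma_gf - 32 * dil 4 sigma_gf)"
proof -
  have "logD (16 * fps_X) (1 :: int fps)" by (simp add: logD_def qD_def)
  from logD_mult[OF this logD_dil_euler[of 4 8]]
  have "logD (th_v * dil 2 euler ^ 4) (1 - 32 * dil 4 sigma_gf)"
    unfolding th_v_eta by simp
  from logD_cancel[OF this logD_dil_euler] show ?thesis
    by (simp add: algebra_simps)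
qed

lemma qD_th_a: "qD th_a = th_a * alpha" and qD_th_b: "qD th_b = th_b * beta"
  using logD_th_a logD_th_b by (simp_all add: logD_def)

text \<open>Differentiating \<open>agm_a\<close> gives the doubling rule for \<open>alpha\<close>;
  \<open>agm_b\<close> gives the one for \<open>beta\<close>.\<close>

lemma dil_alpha: "2 * (th_a + th_b) * dil 2 alpha = th_a * alpha + th_b * beta"
proof -
  have "2 * qD (dil 2 th_a) = qD (th_a + th_b)"
    unfolding agm_a[symmetric] by (simp add: qD_mult)
  moreover have "2 * qD (dil 2 th_a) = 2 * (2 * dil 2 th_a) * dil 2 alpha"
    by (simp add: qD_dil qD_th_a dil_mult)
  ultimately show ?thesis unfolding agm_a by (simp add: qD_add qD_th_a qD_th_b)
qed

lemma dil_beta: "4 * dil 2 beta = alpha + beta"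
proof -
  have "logD (th_a * th_b) (4 * dil 2 beta)"
    using logD_power[OF logD_dil[OF _ logD_th_b], of 2 2] unfolding agm_b by (simp add: mult.assoc)
  from logD_unique[OF this logD_mult[OF logD_th_a logD_th_b]] show ?thesis by simp
qed

text \<open>Both sides solve \<open>4 (th_a + th_b) f(q^2) = (th_a - th_b) f(q)\<close>. A nonzero
  solution of order \<open>s\<close> has \<open>2s = s + 1\<close>, but the difference vanishes to
  order at least 2.\<close>

lemma alpha_minus_beta: "2 * (alpha - beta) = th_v"
proof (rule ccontr)
  define d where "d = 2 * (alpha - beta) - th_v"
  assume "2 * (alpha - beta) \<noteq> th_v"
  then have d: "d \<noteq> 0" by (simp add: d_def)
  have "4 * (th_a + th_b) * dil 2 (2 * (alpha - beta)) = 2 * (alpha - beta) * (th_a - th_b)"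
  proof -
    have "4 * (th_a + th_b) * dil 2 (2 * (alpha - beta))
        = 4 * (2 * (th_a + th_b) * dil 2 alpha) - 2 * (th_a + th_b) * (4 * dil 2 beta)"
      by (simp add: dil_mult fps_compose_sub_distrib algebra_simps)
    then show ?thesis unfolding dil_alpha dil_beta by (simp add: algebra_simps)
  qed
  moreover have "4 * (th_a + th_b) * dil 2 th_v = th_v * (th_a - th_b)"
  proof -
    have "4 * (th_a + th_b) * dil 2 th_v = (th_a + th_b) * (4 * dil 2 th_v)" by simp
    then show ?thesis unfolding agm_v unfolding th_v_def by (simp add: power2_eq_square algebra_simps)
  qed
  ultimately have "4 * (th_a + th_b) * dil 2 d = d * (th_a - th_b)"
    unfolding d_def fps_compose_sub_distrib by (simp add: algebra_simps)
  moreover define s where "s = 4 * (th_a + th_b)"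
  ultimately have eq: "subdegree (s * dil 2 d) = subdegree (d * (th_a - th_b))" by simp
  have m: "subdegree (th_a - th_b) = 1" "th_a - th_b \<noteq> 0"
    by (auto intro!: subdegreeI dest!: arg_cong[of _ _ "\<lambda>h. h $ 1"])
  have "s $ 0 \<noteq> 0" by (simp add: s_def numeral_fps_const)
  then have "subdegree s = 0" "s \<noteq> 0" by auto
  have "subdegree d \<ge> 2"
  proof (rule subdegree_geI[OF d])
    fix i :: nat assume "i < 2"
    then consider "i = 0" | "i = 1" by linarith
    then show "d $ i = 0"
      by cases (simp_all add: d_def alpha_def beta_def dil_nth sigma_gf_def numeral_fps_const)
  qed
  then show False using eq d m \<open>subdegree s = 0\<close> \<open>s \<noteq> 0\<close> by simp
qed

definition eis2 :: "int fps" where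
  "eis2 = 1 - 24 * sigma_gf"

lemma two_beta: "2 * beta = 2 * alpha - th_v"
  using alpha_minus_beta by (simp add: algebra_simps)

text \<open>The logarithmic derivative of \<open>th_v\<close> is computed from \<open>th_a\<close>
  and \<open>th_b\<close> and again from the eta product. Equating the two expresses
  \<open>E_2(q^2)\<close> by \<open>alpha\<close> and the theta series.\<close>

lemma dil_eis2: "dil 2 eis2 = 6 * alpha - th_a ^ 2 + 2 * th_b ^ 2"
proof -
  have "qD th_v = 2 * th_a ^ 2 * alpha - th_b ^ 2 * (2 * beta)"
    by (simp add: th_v_def qD_diff qD_mult qD_th_a qD_th_b power2_eq_square algebra_simps)
  also have "\<dots> = th_v * (2 * alpha + th_b ^ 2)"
    unfolding two_beta by (simp add: th_v_def algebra_simps)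
  finally have "logD th_v (2 * alpha + th_b ^ 2)" by (simp add: logD_def)
  from logD_unique[OF this logD_th_v]
  have *: "1 + 8 * dil 2 sigma_gf - 32 * dil 4 sigma_gf = 2 * alpha + th_b ^ 2" by simp
  have "dil 2 eis2 = (1 + 8 * dil 2 sigma_gf - 32 * dil 4 sigma_gf) + 2 * alpha + 2 * beta"
    by (simp add: eis2_def fps_compose_sub_distrib dil_mult alpha_def beta_def)
  also have "\<dots> = 6 * alpha - th_a ^ 2 + 2 * th_b ^ 2"
    unfolding * two_beta by (simp add: th_v_def)
  finally show ?thesis .
qed

text \<open>Coefficient \<open>n\<close> is 4 times coefficient \<open>n / 2\<close>, or 0 for odd
  \<open>n\<close>; the descent ends at \<open>h $ 0 = 4 * h $ 0\<close>.\<close>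

lemma fps_eq_0_if_dil:
  assumes "4 * dil 2 h = h"
  shows "h = 0"
proof (rule fps_ext)
  fix n show "h $ n = 0 $ n"
  proof (induction n rule: less_induct)
    case (less n)
    have h: "h $ n = 4 * dil 2 h $ n"
      using arg_cong[OF assms, of "\<lambda>f. f $ n"] by (simp add: numeral_fps_const)
    then show ?case using less[of "n div 2"] by (cases "n = 0") (auto simp: dil_nth)
  qed
qed

lemma four_dil_alpha: "4 * dil 2 alpha = 2 * alpha - th_b * (th_a - th_b)"
proof -
  have "(th_a + th_b) * (4 * dil 2 alpha) = 2 * th_a * alpha + th_b * (2 * beta)"
    using arg_cong[OF dil_alpha, of "\<lambda>f. 2 * f"] by (simp add: algebra_simps)
  also have "\<dots> = (th_a + th_b) * (2 * alpha - th_b * (th_a - th_b))"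
    unfolding two_beta by (simp add: th_v_def power2_eq_square algebra_simps)
  finally show ?thesis by (simp only: mult_cancel_left th_nonzero simp_thms)
qed

text \<open>A Riccati equation for \<open>alpha\<close>. Its defect \<open>h\<close> satisfies
  \<open>4 h(q^2) = h(q)\<close> by the doubling rules, so it vanishes.\<close>

lemma qD_alpha: "4 * qD alpha = 4 * alpha ^ 2 + th_b ^ 2 * th_v"
proof -
  define h where "h = 4 * qD alpha - 4 * alpha ^ 2 - th_b ^ 2 * th_v"
  have 1: "8 * dil 2 (qD alpha)
      = 2 * qD alpha - th_b * beta * (th_a - th_b) - th_b * (th_a * alpha - th_b * beta)"
  proof -
    have "8 * dil 2 (qD alpha) = qD (4 * dil 2 alpha)" by (simp add: qD_mult qD_dil)
    then show ?thesis unfolding four_dil_alpha qD_diff qD_mult qD_th_a qD_th_b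
      by (simp add: algebra_simps)
  qed
  have "4 * dil 2 h = 2 * (8 * dil 2 (qD alpha)) - (4 * dil 2 alpha) ^ 2
      - dil 2 th_b ^ 2 * (4 * dil 2 th_v)"
    by (simp add: h_def fps_compose_sub_distrib dil_mult dil_power power_mult_distrib)
  also have "\<dots> = 4 * qD alpha - 4 * alpha ^ 2 + (2 * th_b ^ 2 - th_a * th_b) * (2 * beta)
      - 2 * th_a * th_b * alpha + 4 * alpha * th_b * (th_a - th_b) - th_b * (th_a - th_b) * th_v"
    unfolding 1 four_dil_alpha agm_b agm_v
    unfolding th_v_def by (simp add: power2_eq_square algebra_simps)
  also have "\<dots> = h"
    unfolding two_beta h_def by (simp add: power2_eq_square algebra_simps)
  finally have "h = 0" by (rule fps_eq_0_if_dil)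
  then show ?thesis by (simp add: h_def diff_eq_eq add.commute)
qed

text \<open>The dilation contributes a factor 2 to the derivative, so 12 becomes 6;
  \<open>qD_alpha\<close> then eliminates \<open>alpha\<close>.\<close>

lemma dil_eis2_square:
  "dil 2 (eis2 ^ 2 - 12 * qD eis2) = th_a ^ 4 - th_a ^ 2 * th_b ^ 2 + th_b ^ 4"
proof -
  have "dil 2 (eis2 ^ 2 - 12 * qD eis2) = dil 2 eis2 ^ 2 - 6 * qD (dil 2 eis2)"
    by (simp add: fps_compose_sub_distrib dil_mult dil_power qD_dil)
  also have "\<dots> = (6 * alpha - th_a ^ 2 + 2 * th_b ^ 2) ^ 2
      - 9 * (4 * qD alpha) + 12 * th_a ^ 2 * alpha - 12 * th_b ^ 2 * (2 * beta)"
    unfolding dil_eis2 by (simp add: qD_add qD_diff qD_mult qD_th_a qD_th_b power2_eq_square algebra_simps)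
  also have "\<dots> = th_a ^ 4 - th_a ^ 2 * th_b ^ 2 + th_b ^ 4"
    unfolding qD_alpha two_beta th_v_def
    by (simp add: power2_eq_square power4_eq_xxxx algebra_simps)
  finally show ?thesis .
qed

subsection \<open>The convolution of divisor sums\<close>

definition factor_pairs :: "nat \<Rightarrow> (nat \<times> nat) set" where
  "factor_pairs n = {(a, x). a > 0 \<and> x > 0 \<and> a * x = n}"

lemma finite_factor_pairs: "finite (factor_pairs n)"
  by (rule finite_subset[of _ "{..n} \<times> {..n}"]) (auto simp: factor_pairs_def)

lemma sum_factor_pairs:
  assumes "n > 0"
  shows "(\<Sum>(a, x)\<in>factor_pairs n. g a x) = (\<Sum>d | d dvd n. g d (n div d))"
  using assms
  by (intro sum.reindex_bij_witness[where i = "\<lambda>d. (d, n div d)" and j = fst])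
     (auto simp: factor_pairs_def intro: Nat.gr0I)

lemma sigma_gf_nth: "sigma_gf $ n = (\<Sum>(a, x)\<in>factor_pairs n. int a)"
proof (cases "n = 0")
  case True
  have "factor_pairs 0 = {}" by (auto simp: factor_pairs_def)
  with True show ?thesis by (simp add: sigma_gf_def)
qed (simp add: sigma_gf_def sum_factor_pairs)

text \<open>Summing \<open>a b\<close> over these solutions of \<open>a x + b y = n\<close> gives
  the convolution of the divisor sum with itself.\<close>

definition quads :: "nat \<Rightarrow> ((nat \<times> nat) \<times> (nat \<times> nat)) set" where
  "quads n = {((a, x), (b, y)). a > 0 \<and> x > 0 \<and> b > 0 \<and> y > 0 \<and> a * x + b * y = n}"

lemma quads_eq: "quads n = (\<Union>k\<le>n. factor_pairs k \<times> factor_pairs (n - k))"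
  by (auto simp: quads_def factor_pairs_def)

lemma finite_quads [simp]: "finite (quads n)"
  unfolding quads_eq by (intro finite_UN_I finite_cartesian_product finite_factor_pairs) simp

lemma sigma_gf_square_nth: "(sigma_gf ^ 2) $ n = (\<Sum>((a, x), (b, y))\<in>quads n. int a * int b)"
proof -
  have "(\<Sum>((a, x), (b, y))\<in>quads n. int a * int b)
      = (\<Sum>k\<le>n. \<Sum>((a, x), (b, y))\<in>factor_pairs k \<times> factor_pairs (n - k). int a * int b)"
    unfolding quads_eq
    by (rule sum.UNION_disjoint) (simp_all add: finite_factor_pairs, auto simp: factor_pairs_def)
  also have "\<dots> = (\<Sum>k\<le>n. sigma_gf $ k * sigma_gf $ (n - k))"
    unfolding sigma_gf_nth sum_product sum.cartesian_product by (simp add: case_prod_unfold)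
  finally show ?thesis by (simp add: power2_eq_square fps_mult_nth atLeast0AtMost)
qed

text \<open>Liouville's method: the sum of \<open>4ab = (a + b)\<^sup>2 - (a - b)\<^sup>2\<close> over \<open>ax + by = n\<close> telescopes
  to the diagonals \<open>x = y\<close> and \<open>a = b\<close>, because \<open>(a, x, b, y) \<mapsto> (a + b, y, a, x - y)\<close> and
  \<open>(a, x, b, y) \<mapsto> (a, x - y, a + b, y)\<close> identify the region \<open>x > y\<close> with the regions
  \<open>a > b\<close> and \<open>a < b\<close>.\<close>

lemma sum_quads_split:
  fixes g :: "_ \<Rightarrow> int"
  shows "sum g (quads n) = sum g {((a, x), (b, y)) \<in> quads n. x > y}
    + sum g {((a, x), (b, y)) \<in> quads n. x < y} + sum g {((a, x), (b, y)) \<in> quads n. x = y}" (is ?X)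
  and "sum g (quads n) = sum g {((a, x), (b, y)) \<in> quads n. a > b}
    + sum g {((a, x), (b, y)) \<in> quads n. a < b} + sum g {((a, x), (b, y)) \<in> quads n. a = b}" (is ?A)
proof -
  have split: "sum g (quads n) = sum g A + sum g B + sum g C"
    if "quads n = A \<union> B \<union> C" "A \<inter> B = {}" "(A \<union> B) \<inter> C = {}" for A B C
  proof -
    have "finite A" "finite B" "finite C" using finite_quads[of n] that(1) by auto
    then show ?thesis unfolding that(1) using that(2,3) by (simp add: sum.union_disjoint)
  qed
  show ?X by (rule split) auto
  show ?A by (rule split) auto
qed

lemma quads_swap:
  "(\<Sum>((a, x), (b, y))\<in>{((a, x), (b, y)) \<in> quads n. P a x b y}. g a x b y)
    = (\<Sum>((a, x), (b, y))\<in>{((a, x), (b, y)) \<in> quads n. P b y a x}. g b y a x)"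
  by (rule sum.reindex_bij_witness[where i = "\<lambda>(p, r). (r, p)" and j = "\<lambda>(p, r). (r, p)"])
     (auto simp: quads_def)

lemma quads_shift_left:
  "(\<Sum>((a, x), (b, y))\<in>{((a, x), (b, y)) \<in> quads n. x > y}. g a b)
    = (\<Sum>((a, x), (b, y))\<in>{((a, x), (b, y)) \<in> quads n. a > b}. g b (a - b))"
proof (rule sum.reindex_bij_witness[
    where i = "\<lambda>((a, x), (b, y)). ((b, x + y), (a - b, x))"
      and j = "\<lambda>((a, x), (b, y)). ((a + b, y), (a, x - y))"])
  fix t assume "t \<in> {((a, x), (b, y)) \<in> quads n. x > y}"
  then obtain a x b y where t: "t = ((a, x), (b, y))" "0 < a" "0 < b" "0 < y" "x > y" "a * x + b * y = n"
    by (auto simp: quads_def)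
  then obtain z where z: "x = y + z" "z > 0" by (metis less_imp_add_positive)
  show "(\<lambda>((a, x), (b, y)). ((a + b, y), (a, x - y))) t \<in> {((a, x), (b, y)) \<in> quads n. a > b}"
    using t z by (auto simp: quads_def algebra_simps)
  show "(\<lambda>((a, x), (b, y)). ((b, x + y), (a - b, x))) ((\<lambda>((a, x), (b, y)). ((a + b, y), (a, x - y))) t) = t"
    using t z by simp
  show "(\<lambda>((a, x), (b, y)). g b (a - b)) ((\<lambda>((a, x), (b, y)). ((a + b, y), (a, x - y))) t)
      = (\<lambda>((a, x), (b, y)). g a b) t"
    using t by simp
next
  fix t assume "t \<in> {((a, x), (b, y)) \<in> quads n. a > b}"
  then obtain a x b y where t: "t = ((a, x), (b, y))" "0 < b" "0 < x" "0 < y" "a > b" "a * x + b * y = n"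
    by (auto simp: quads_def)
  then obtain c where c: "a = b + c" "c > 0" by (metis less_imp_add_positive)
  show "(\<lambda>((a, x), (b, y)). ((b, x + y), (a - b, x))) t \<in> {((a, x), (b, y)) \<in> quads n. x > y}"
    using t c by (auto simp: quads_def algebra_simps)
  show "(\<lambda>((a, x), (b, y)). ((a + b, y), (a, x - y))) ((\<lambda>((a, x), (b, y)). ((b, x + y), (a - b, x))) t) = t"
    using t c by simp
qed

lemma quads_shift_right:
  "(\<Sum>((a, x), (b, y))\<in>{((a, x), (b, y)) \<in> quads n. x > y}. g a)
    = (\<Sum>((a, x), (b, y))\<in>{((a, x), (b, y)) \<in> quads n. a < b}. g a)"
proof (rule sum.reindex_bij_witness[
    where i = "\<lambda>((a, x), (b, y)). ((a, x + y), (b - a, y))"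
      and j = "\<lambda>((a, x), (b, y)). ((a, x - y), (a + b, y))"])
  fix t assume "t \<in> {((a, x), (b, y)) \<in> quads n. x > y}"
  then obtain a x b y where t: "t = ((a, x), (b, y))" "0 < a" "0 < b" "0 < y" "x > y" "a * x + b * y = n"
    by (auto simp: quads_def)
  then obtain z where z: "x = y + z" "z > 0" by (metis less_imp_add_positive)
  show "(\<lambda>((a, x), (b, y)). ((a, x - y), (a + b, y))) t \<in> {((a, x), (b, y)) \<in> quads n. a < b}"
    using t z by (auto simp: quads_def algebra_simps)
  show "(\<lambda>((a, x), (b, y)). ((a, x + y), (b - a, y))) ((\<lambda>((a, x), (b, y)). ((a, x - y), (a + b, y))) t) = t"
    using t z by simp
  show "(\<lambda>((a, x), (b, y)). g a) ((\<lambda>((a, x), (b, y)). ((a, x - y), (a + b, y))) t)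
      = (\<lambda>((a, x), (b, y)). g a) t"
    using t by simp
next
  fix t assume "t \<in> {((a, x), (b, y)) \<in> quads n. a < b}"
  then obtain a x b y where t: "t = ((a, x), (b, y))" "0 < a" "0 < x" "0 < y" "a < b" "a * x + b * y = n"
    by (auto simp: quads_def)
  then obtain c where c: "b = a + c" "c > 0" by (metis less_imp_add_positive)
  show "(\<lambda>((a, x), (b, y)). ((a, x + y), (b - a, y))) t \<in> {((a, x), (b, y)) \<in> quads n. x > y}"
    using t c by (auto simp: quads_def algebra_simps)
  show "(\<lambda>((a, x), (b, y)). ((a, x - y), (a + b, y))) ((\<lambda>((a, x), (b, y)). ((a, x + y), (b - a, y))) t) = t"
    using t c by simp
qed

text \<open>For \<open>x = y\<close> the equation is \<open>(a + b) x = n\<close>, so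
  \<open>d = a + b\<close> runs over the divisors of \<open>n\<close> and \<open>b\<close> over the
  ways to split \<open>d\<close>.\<close>

lemma sum_quads_diagonal_x:
  fixes g :: "nat \<Rightarrow> nat \<Rightarrow> int"
  assumes "n > 0"
  shows "(\<Sum>((a, x), (b, y))\<in>{((a, x), (b, y)) \<in> quads n. x = y}. g a b)
    = (\<Sum>d | d dvd n. \<Sum>b = 1..<d. g (d - b) b)"
proof -
  have "(\<Sum>d | d dvd n. \<Sum>b = 1..<d. g (d - b) b)
      = (\<Sum>(d, b)\<in>(SIGMA d:{d. d dvd n}. {1..<d}). g (d - b) b)"
    using assms by (subst sum.Sigma) auto
  also have "\<dots> = (\<Sum>((a, x), (b, y))\<in>{((a, x), (b, y)) \<in> quads n. x = y}. g a b)"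
  proof (rule sum.reindex_bij_witness[
      where i = "\<lambda>((a, x), (b, y)). (a + b, b)"
        and j = "\<lambda>(d, b). ((d - b, n div d), (b, n div d))"])
    fix t assume "t \<in> (SIGMA d:{d. d dvd n}. {1..<d})"
    then obtain d b k where t: "t = (d, b)" "b > 0" "d > b" "n = d * k" by auto
    then obtain c where c: "d = b + c" "c > 0" by (metis less_imp_add_positive)
    show "(\<lambda>(d, b). ((d - b, n div d), (b, n div d))) t \<in> {((a, x), (b, y)) \<in> quads n. x = y}"
    proof -
      have "d > 0" using c by simp
      then have "n div d = k" by (simp add: t(4))
      moreover have "k > 0" "n = c * k + b * k"
        using t(4) c(1) assms by (auto simp: add_mult_distrib intro: Nat.gr0I)
      ultimately show ?thesis using t c by (simp add: quads_def)
    qed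
    show "(\<lambda>((a, x), (b, y)). (a + b, b)) ((\<lambda>(d, b). ((d - b, n div d), (b, n div d))) t) = t"
      using t by simp
    show "(\<lambda>((a, x), (b, y)). g a b) ((\<lambda>(d, b). ((d - b, n div d), (b, n div d))) t)
      = (\<lambda>(d, b). g (d - b) b) t"
      using t by simp
  next
    fix t assume "t \<in> {((a, x), (b, y)) \<in> quads n. x = y}"
    then obtain a x b where t: "t = ((a, x), (b, x))" "0 < a" "0 < b" "0 < x" "n = (a + b) * x"
      by (auto simp: quads_def algebra_simps)
    then show "(\<lambda>((a, x), (b, y)). (a + b, b)) t \<in> (SIGMA d:{d. d dvd n}. {1..<d})" by auto
    show "(\<lambda>(d, b). ((d - b, n div d), (b, n div d))) ((\<lambda>((a, x), (b, y)). (a + b, b)) t) = t"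
      using t by simp
  qed
  finally show ?thesis by simp
qed

lemma sum_quads_diagonal_a:
  fixes g :: "nat \<Rightarrow> int"
  assumes "n > 0"
  shows "(\<Sum>((a, x), (b, y))\<in>{((a, x), (b, y)) \<in> quads n. a = b}. g b)
    = (\<Sum>d | d dvd n. int (n div d - 1) * g d)"
proof -
  have "(\<Sum>d | d dvd n. int (n div d - 1) * g d) = (\<Sum>d | d dvd n. \<Sum>x = 1..<n div d. g d)"
    by simp
  also have "\<dots> = (\<Sum>(d, x)\<in>(SIGMA d:{d. d dvd n}. {1..<n div d}). g d)"
    using assms by (subst sum.Sigma) auto
  also have "\<dots> = (\<Sum>((a, x), (b, y))\<in>{((a, x), (b, y)) \<in> quads n. a = b}. g b)"
  proof (rule sum.reindex_bij_witness[
      where i = "\<lambda>((a, x), (b, y)). (a, x)"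
        and j = "\<lambda>(d, x). ((d, x), (d, n div d - x))"])
    fix t assume "t \<in> (SIGMA d:{d. d dvd n}. {1..<n div d})"
    then obtain d x where t: "t = (d, x)" "x > 0" "x < n div d" and "d dvd n" by auto
    then obtain k where k: "n = d * k" by (elim dvdE)
    then have "d > 0" "x < k" using assms t by (auto intro: Nat.gr0I)
    then obtain c where c: "k = x + c" "c > 0" by (metis less_imp_add_positive)
    show "(\<lambda>(d, x). ((d, x), (d, n div d - x))) t \<in> {((a, x), (b, y)) \<in> quads n. a = b}"
      using t k c \<open>d > 0\<close> by (auto simp: quads_def algebra_simps)
    show "(\<lambda>((a, x), (b, y)). (a, x)) ((\<lambda>(d, x). ((d, x), (d, n div d - x))) t) = t"
      using t by simp
    show "(\<lambda>((a, x), (b, y)). g b) ((\<lambda>(d, x). ((d, x), (d, n div d - x))) t)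
      = (\<lambda>(d, x). g d) t"
      using t by simp
  next
    fix t assume "t \<in> {((a, x), (b, y)) \<in> quads n. a = b}"
    then obtain a x y where t: "t = ((a, x), (a, y))" "0 < a" "0 < x" "0 < y" "n = a * (x + y)"
      by (auto simp: quads_def algebra_simps)
    then show "(\<lambda>((a, x), (b, y)). (a, x)) t \<in> (SIGMA d:{d. d dvd n}. {1..<n div d})" by auto
    show "(\<lambda>(d, x). ((d, x), (d, n div d - x))) ((\<lambda>((a, x), (b, y)). (a, x)) t) = t"
      using t by simp
  qed
  finally show ?thesis by simp
qed

lemma sum_squares_below: "6 * (\<Sum>b = 1..<d. int b ^ 2) = int d * (int d - 1) * (2 * int d - 1)"
proof (induction d)
  case (Suc d)
  show ?case
  proof (cases "d = 0")
    case False
    then have "6 * (\<Sum>b = 1..<Suc d. int b ^ 2) = 6 * (\<Sum>b = 1..<d. int b ^ 2) + 6 * int d ^ 2"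
      by simp
    then show ?thesis unfolding Suc by (simp add: power2_eq_square algebra_simps)
  qed simp
qed simp

text \<open>The shifts turn \<open>(a + b)^2\<close> on \<open>x > y\<close> into \<open>a^2\<close>
  on \<open>a > b\<close>, and \<open>(a - b)^2\<close> on \<open>a > b\<close> into
  \<open>b^2\<close> on \<open>x > y\<close>.\<close>

lemma sigma_convolution:
  assumes "n > 0"
  shows "12 * (sigma_gf ^ 2) $ n
    = 5 * (\<Sum>d | d dvd n. int d ^ 3) + (1 - 6 * int n) * (\<Sum>d | d dvd n. int d)"
proof -
  let ?X = "\<lambda>R g. \<Sum>((a, x), (b, y))\<in>{((a, x), (b, y)) \<in> quads n. R x y}. (g a b :: int)"
  let ?A = "\<lambda>R g. \<Sum>((a, x), (b, y))\<in>{((a, x), (b, y)) \<in> quads n. R a b}. (g a b :: int)"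
  let ?T = "\<lambda>g. \<Sum>((a, x), (b, y))\<in>quads n. (g a b :: int)"
  have TX: "?T g = ?X (>) g + ?X (<) g + ?X (=) g" for g by (rule sum_quads_split(1))
  have TA: "?T g = ?A (>) g + ?A (<) g + ?A (=) g" for g by (rule sum_quads_split(2))
  have sX: "?X (<) g = ?X (>) (\<lambda>a b. g b a)" for g
    by (rule quads_swap[where P = "\<lambda>a x b y. x < y" and g = "\<lambda>a x b y. g a b"])
  have sA: "?A (<) g = ?A (>) (\<lambda>a b. g b a)" for g
    by (rule quads_swap[where P = "\<lambda>a x b y. a < b" and g = "\<lambda>a x b y. g a b"])
  define U V where "U = (\<lambda>(a::nat) (b::nat). (int a + int b) ^ 2)" and "V = (\<lambda>(a::nat) (b::nat). (int a - int b) ^ 2)"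
  define P Q where "P = (\<lambda>(a::nat) (b::nat). int a ^ 2)" and "Q = (\<lambda>(a::nat) (b::nat). int b ^ 2)"
  define R where "R = (\<lambda>d. \<Sum>b = 1..<d. int b ^ 2)"
  have UX: "?X (<) U = ?X (>) U" and VA: "?A (<) V = ?A (>) V"
    and QX: "?X (<) Q = ?X (>) P" and PA: "?A (<) P = ?A (>) Q" and QA: "?A (<) Q = ?A (>) P"
    unfolding sX sA
    by (simp_all add: U_def V_def P_def Q_def add.commute power2_commute)
  have "4 * (sigma_gf ^ 2) $ n = (\<Sum>t\<in>quads n. case t of ((a, x), (b, y)) \<Rightarrow> U a b - V a b)"
    unfolding sigma_gf_square_nth sum_distrib_left
    by (intro sum.cong refl) (auto simp: U_def V_def power2_eq_square algebra_simps)
  also have "\<dots> = ?T U - ?T V"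
    by (simp add: case_prod_unfold sum_subtractf)
  also have "?T U = 2 * ?X (>) U + ?X (=) U"
    unfolding TX[of U] UX by simp
  also have "?X (>) U = ?A (>) P"
    unfolding quads_shift_left by (intro sum.cong refl) (auto simp: U_def P_def of_nat_diff)
  also have "?T V = 2 * ?A (>) V"
  proof -
    have "?A (=) V = 0" by (intro sum.neutral) (auto simp: V_def)
    then show ?thesis unfolding TA[of V] VA by simp
  qed
  also have "?A (>) V = ?X (>) Q"
    unfolding quads_shift_left by (intro sum.cong refl) (auto simp: V_def Q_def of_nat_diff)
  finally have "4 * (sigma_gf ^ 2) $ n = 2 * ?A (>) P + ?X (=) U - 2 * ?X (>) Q" by simp
  moreover have "?X (>) P = ?A (<) P"
    unfolding P_def by (rule quads_shift_right)
  \<comment> \<open>Splitting the sum of \<open>b^2\<close> by \<open>x, y\<close> and by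
    \<open>a, b\<close> trades the remaining regions for the two diagonals.\<close>
  ultimately have "4 * (sigma_gf ^ 2) $ n = ?X (=) U + 2 * ?X (=) Q - 2 * ?A (=) Q"
    using TX[of Q] TA[of Q] QX PA QA by linarith
  also have "?X (=) U = (\<Sum>d | d dvd n. (int d - 1) * int d ^ 2)"
  proof -
    have "(\<Sum>b = 1..<d. U (d - b) b) = (int d - 1) * int d ^ 2" if "d dvd n" for d
    proof -
      have "d > 0" using that assms by (auto intro: Nat.gr0I)
      have "(\<Sum>b = 1..<d. U (d - b) b) = (\<Sum>b = 1..<d. int d ^ 2)"
        by (intro sum.cong refl) (auto simp: U_def of_nat_diff)
      then show ?thesis using \<open>d > 0\<close> by (simp add: of_nat_diff)
    qed
    then show ?thesis unfolding sum_quads_diagonal_x[OF assms] by simp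
  qed
  also have "?X (=) Q = (\<Sum>d | d dvd n. R d)"
    unfolding sum_quads_diagonal_x[OF assms] Q_def R_def ..
  also have "?A (=) Q = (\<Sum>d | d dvd n. int n * int d - int d ^ 2)"
  proof -
    have "int (n div d - 1) * int d ^ 2 = int n * int d - int d ^ 2" if "d dvd n" for d
    proof -
      obtain k where k: "n = d * k" using \<open>d dvd n\<close> by (elim dvdE)
      have "d > 0" "k > 0" using k assms by (auto intro: Nat.gr0I)
      then show ?thesis by (simp add: k of_nat_diff power2_eq_square algebra_simps)
    qed
    then show ?thesis unfolding Q_def sum_quads_diagonal_a[OF assms] by simp
  qed
  finally have "3 * (4 * (sigma_gf ^ 2) $ n) = (\<Sum>d | d dvd n. 3 * ((int d - 1) * int d ^ 2)
      + 6 * R d - 6 * (int n * int d - int d ^ 2))"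
    unfolding sum.distrib sum_subtractf sum_distrib_left[symmetric] by simp
  also have "\<dots> = (\<Sum>d | d dvd n. 5 * int d ^ 3 + (1 - 6 * int n) * int d)"
    unfolding R_def sum_squares_below
    by (intro sum.cong refl) (simp add: power2_eq_square power3_eq_cube algebra_simps)
  finally show ?thesis by (simp add: sum_distrib_left sum.distrib)
qed

text \<open>Ramanujan's differential equation for \<open>E_2\<close>;
  \<open>sigma_convolution\<close> supplies the coefficients of \<open>sigma_gf ^ 2\<close>.\<close>

lemma eis2_square: "eis2 ^ 2 - 12 * qD eis2 = eisenstein_E4"
proof (rule fps_ext)
  fix n
  have eq: "eis2 ^ 2 - 12 * qD eis2 = 1 - 48 * sigma_gf + 48 * (12 * sigma_gf ^ 2) + 288 * qD sigma_gf"
    by (simp add: eis2_def qD_diff qD_mult power2_eq_square algebra_simps)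
  show "(eis2 ^ 2 - 12 * qD eis2) $ n = eisenstein_E4 $ n"
  proof (cases "n = 0")
    case True
    then show ?thesis unfolding eq
      by (simp add: eisenstein_E4_def qD_nth numeral_fps_const power2_eq_square sigma_gf_def)
  next
    case False
    then have "(eis2 ^ 2 - 12 * qD eis2) $ n = - 48 * sigma_gf $ n
        + 48 * (12 * (sigma_gf ^ 2) $ n) + 288 * int n * sigma_gf $ n"
      unfolding eq by (simp add: qD_nth numeral_fps_const)
    then show ?thesis unfolding sigma_convolution[OF False[unfolded neq0_conv]] using False
      by (simp add: sigma_gf_def eisenstein_E4_def algebra_simps)
  qed
qed

lemma dil_eisenstein_E4: "dil 2 eisenstein_E4 = th_a ^ 4 - th_a ^ 2 * th_b ^ 2 + th_b ^ 4"
  using dil_eis2_square unfolding eis2_square .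

subsection \<open>The Hasse invariant and the operator \<open>U\<close> modulo 11\<close>

lemma rcong_11_iff: "rcong 11 f g \<longleftrightarrow> (\<forall>n. [f $ n = (g :: int fps) $ n] (mod 11))"
  using fps_cong_iff_rcong[of f g 11] by (simp add: fps_cong_def)

text \<open>The coefficients are the \<open>(5 choose k)\<^sup>2\<close>; up to sign, this is the Hasse invariant of the Legendre
  curve with \<open>\<lambda> = 1 - y / x\<close> at the prime \<open>11\<close>.\<close>

definition hasse :: "int fps \<Rightarrow> int fps \<Rightarrow> int fps" where
  "hasse x y = x ^ 5 + 25 * x ^ 4 * y + 100 * x ^ 3 * y ^ 2 + 100 * x ^ 2 * y ^ 3
     + 25 * x * y ^ 4 + y ^ 5"

text \<open>One step of the mean, with both arguments scaled by 4, preserves the quintic modulo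
  11.\<close>

lemma hasse_agm:
  "hasse ((a + b) ^ 2) (4 * (a * b)) = hasse (a ^ 2) (b ^ 2)
     + 11 * (10 * a * b ^ 9 + 220 * a ^ 2 * b ^ 8 + 1720 * a ^ 3 * b ^ 7 + 5610 * a ^ 4 * b ^ 6
        + 8316 * a ^ 5 * b ^ 5 + 5610 * a ^ 6 * b ^ 4 + 1720 * a ^ 7 * b ^ 3
        + 220 * a ^ 8 * b ^ 2 + 10 * a ^ 9 * b)"
  unfolding hasse_def by (simp add: eval_nat_numeral) algebra

text \<open>The scaling contributes \<open>4^5 = 1024\<close>, which is 1 modulo 11, so the value is
  invariant under \<open>q \<mapsto> q^2\<close>. Descent on the index leaves the constant term 252,
  which is -1 modulo 11.\<close>

lemma hasse_cong: "rcong 11 (hasse (th_a ^ 2) (th_b ^ 2)) (- 1)"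
proof -
  define w where "w = hasse (th_a ^ 2) (th_b ^ 2)"
  have "1024 * dil 2 w = hasse ((2 * dil 2 th_a) ^ 2) (4 * dil 2 th_b ^ 2)"
    by (simp add: w_def hasse_def fps_compose_add_distrib dil_mult dil_power power_mult_distrib
          distrib_left)
  also have "rcong 11 \<dots> w"
    unfolding agm_a agm_b hasse_agm w_def rcong_def add_diff_cancel_left' by (rule dvd_triv_left)
  finally have "rcong 11 (1024 * dil 2 w) w" .
  moreover have "rcong 11 (1024 * dil 2 w) (dil 2 w)"
  proof -
    have "1024 * dil 2 w - dil 2 w = 11 * (93 * dil 2 w)" by simp
    then show ?thesis unfolding rcong_def by (metis dvd_triv_left)
  qed
  ultimately have "rcong 11 w (dil 2 w)" by (metis rcong_sym rcong_trans)
  then have step: "[w $ n = dil 2 w $ n] (mod 11)" for n by (simp add: rcong_11_iff)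
  have "[w $ n = (- 1 :: int fps) $ n] (mod 11)" for n
  proof (induction n rule: less_induct)
    case (less n)
    show ?case
    proof (cases "n = 0")
      case True
      have "w $ 0 = 252" by (simp add: w_def hasse_def numeral_fps_const fps_nth_power_0)
      then show ?thesis using True by (simp add: cong_def)
    next
      case False
      then show ?thesis using step[of n] less[of "n div 2"] False
        by (cases "even n") (auto simp: dil_nth elim!: evenE intro: cong_trans)
    qed
  qed
  then show ?thesis unfolding w_def by (simp add: rcong_11_iff)
qed

section \<open>The operator \<open>U11\<close> and the Frobenius map\<close>

definition U11 :: "int fps \<Rightarrow> int fps" where
  "U11 f = Abs_fps (\<lambda>n. f $ (11 * n))"

lemma U11_nth [simp]: "U11 f $ n = f $ (11 * n)"
  by (simp add: U11_def)

lemma U11_add: "U11 (f + g) = U11 f + U11 g"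
  by (rule fps_ext) simp

lemma U11_sum: "U11 (sum f I) = (\<Sum>i\<in>I. U11 (f i))"
  by (rule fps_ext) (simp add: fps_sum_nth)

lemma U11_of_int_mult: "U11 (of_int c * f) = of_int c * U11 f"
  by (rule fps_ext) (simp add: fps_of_int[symmetric])

lemma U11_cong: "rcong 11 f g \<Longrightarrow> rcong 11 (U11 f) (U11 g)"
  by (simp add: rcong_11_iff)

lemma U11_mult_dil: "U11 (f * dil 11 g) = U11 f * g"
proof (rule fps_ext)
  fix n
  have "U11 (f * dil 11 g) $ n = (\<Sum>i=0..11 * n. dil 11 g $ i * f $ (11 * n - i))"
    by (simp add: mult.commute[of f] fps_mult_nth)
  also have "\<dots> = (\<Sum>i\<in>(*) 11 ` {0..n}. dil 11 g $ i * f $ (11 * n - i))"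
    by (rule sum.mono_neutral_right) (auto simp: dil_nth)
  also have "\<dots> = (\<Sum>j=0..n. g $ j * f $ (11 * (n - j)))"
    by (subst sum.reindex) (auto simp: inj_on_def dil_nth diff_mult_distrib2)
  also have "\<dots> = (U11 f * g) $ n"
    by (simp add: mult.commute[of "U11 f"] fps_mult_nth)
  finally show "U11 (f * dil 11 g) $ n = (U11 f * g) $ n" .
qed

lemma U11_qD: "rcong 11 (U11 (qD f)) 0"
  by (simp add: rcong_11_iff qD_nth cong_0_iff)

lemma rcong_freshman: "rcong 11 ((u + w) ^ 11) (u ^ 11 + (w :: int fps) ^ 11)"
proof -
  have "(u + w) ^ 11 = (\<Sum>k\<le>11. of_nat (11 choose k) * u ^ k * w ^ (11 - k))"
    by (rule binomial_ring)
  also have "rcong 11 \<dots> (\<Sum>k\<le>11. if k \<in> {0, 11} then u ^ k * w ^ (11 - k) else 0)"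
  proof (rule rcong_sum)
    fix k :: nat assume "k \<in> {..11}"
    show "rcong 11 (of_nat (11 choose k) * u ^ k * w ^ (11 - k))
        (if k \<in> {0, 11} then u ^ k * w ^ (11 - k) else 0)"
    proof (cases "k \<in> {0, 11}")
      case False
      with \<open>k \<in> {..11}\<close> have "11 dvd (11 choose k)" by (intro dvd_choose_prime) auto
      then obtain j where "11 choose k = 11 * j" by (elim dvdE)
      then have "of_nat (11 choose k) = (11 * of_nat j :: int fps)" by simp
      then show ?thesis using False by (simp add: rcong_def mult.assoc)
    qed auto
  qed
  also have "(\<Sum>k\<le>11::nat. if k \<in> {0, 11} then u ^ k * w ^ (11 - k) else 0)
      = (\<Sum>k\<in>{0, 11}. u ^ k * w ^ (11 - k))"
    by (rule sum.mono_neutral_cong_right) auto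
  finally show ?thesis by (simp add: add.commute)
qed

lemma int_fermat_11: "[c ^ 11 = (c :: int)] (mod 11)"
proof -
  have "c mod 11 \<in> {0, 1, 2, 3, 4, 5, 6, 7, 8, 9, 10}"
    unfolding insert_iff empty_iff by presburger
  then have "(c mod 11) ^ 11 mod 11 = c mod 11" by auto
  then show ?thesis by (simp add: cong_def power_mod)
qed

text \<open>Writing \<open>h = c + q g\<close> reduces coefficient \<open>n\<close> of
  \<open>h ^ 11\<close> to coefficient \<open>n - 11\<close> of \<open>g ^ 11\<close>, and
  \<open>c ^ 11\<close> to \<open>c\<close> by Fermat.\<close>

lemma rcong_frobenius: "rcong 11 (h ^ 11) (dil 11 h)"
proof -
  have "[(h ^ 11) $ n = dil 11 h $ n] (mod 11)" for n
  proof (induction n arbitrary: h rule: less_induct)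
    case (less n)
    define c g where "c = h $ 0" and "g = fps_shift 1 h"
    have h: "h = fps_const c + fps_X * g"
      by (rule fps_ext) (auto simp: c_def g_def)
    have "[(h ^ 11) $ n = (fps_const c ^ 11 + (fps_X * g) ^ 11) $ n] (mod 11)"
      using rcong_freshman[of "fps_const c" "fps_X * g"] unfolding h[symmetric] rcong_11_iff by blast
    also have "(fps_const c ^ 11 + (fps_X * g) ^ 11) $ n
        = (if n = 0 then c ^ 11 else 0) + (if n < 11 then 0 else (g ^ 11) $ (n - 11))"
      by (simp add: power_mult_distrib fps_X_power_mult_nth fps_const_power)
    also have "[\<dots> = (if n = 0 then c else 0) + (if n < 11 then 0 else dil 11 g $ (n - 11))] (mod 11)"
      by (intro cong_add) (auto intro: int_fermat_11 less)
    also have "(if n = 0 then c else 0) + (if n < 11 then 0 else dil 11 g $ (n - 11)) = dil 11 h $ n"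
    proof (cases "n < 11")
      case True
      then show ?thesis by (auto simp: dil_nth c_def dest: dvd_imp_le)
    next
      case False
      then obtain m where "n = m + 11" by (metis add.commute le_Suc_ex not_less)
      then show ?thesis by (simp add: dil_nth g_def)
    qed
    finally show ?case .
  qed
  then show ?thesis by (simp add: rcong_11_iff)
qed

text \<open>Divisors that are multiples of 11 drop out, and the other divisors of
  \<open>11 n\<close> are those of \<open>n\<close>.\<close>

lemma sigma_11: "[(\<Sum>d | d dvd 11 * n. int d) = (\<Sum>d | d dvd n. int d)] (mod 11)" if "n > 0" for n :: nat
proof -
  have red: "[(\<Sum>d | d dvd m. int d) = (\<Sum>d | d dvd m \<and> \<not> 11 dvd d. int d)] (mod 11)"
    if "m > 0" for m :: nat
  proof -
    have "[(\<Sum>d | d dvd m. int d) = (\<Sum>d | d dvd m. if 11 dvd d then 0 else int d)] (mod 11)"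
      by (intro cong_sum) (auto simp: cong_0_iff)
    also have "(\<Sum>d | d dvd m. if 11 dvd d then 0 else int d) = (\<Sum>d | d dvd m \<and> \<not> 11 dvd d. int d)"
      using that by (intro sum.mono_neutral_cong_right) auto
    finally show ?thesis .
  qed
  have "{d. d dvd 11 * n \<and> \<not> 11 dvd d} = {d. d dvd n \<and> \<not> 11 dvd d}"
  proof -
    have "d dvd n" if "d dvd 11 * n" "\<not> 11 dvd d" for d
    proof -
      have "coprime 11 d" using that(2) by (intro prime_imp_coprime) auto
      then show ?thesis using that(1) by (simp add: coprime_dvd_mult_right_iff coprime_commute)
    qed
    then show ?thesis by auto
  qed
  then show ?thesis using red[of n] red[of "11 * n"] that by (simp add: cong_def)
qed

lemma U11_sigma_gf:
  assumes "k > 0" "coprime k 11"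
  shows "rcong 11 (U11 (dil k sigma_gf)) (dil k sigma_gf)"
  unfolding rcong_11_iff
proof
  fix n
  have dvd: "k dvd 11 * n \<longleftrightarrow> k dvd n" using assms(2) by (rule coprime_dvd_mult_right_iff)
  show "[U11 (dil k sigma_gf) $ n = dil k sigma_gf $ n] (mod 11)"
  proof (cases "k dvd n \<and> n \<noteq> 0")
    case True
    then obtain m where m: "n = k * m" "m > 0" by (auto elim: dvdE)
    have "11 * n div k = 11 * m" using m assms(1) by simp
    then show ?thesis using m assms(1) sigma_11[OF m(2)] by (simp add: dil_nth sigma_gf_def)
  qed (auto simp: dil_nth assms(1) dvd)
qed

lemma U11_th_v: "rcong 11 (U11 th_v) th_v"
proof -
  \<comment> \<open>\<open>dil 1\<close> is written out so that \<open>U11_sigma_gf\<close> covers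
    all three terms; 1, 2 and 4 are coprime to 11.\<close>
  have v: "th_v = 16 * dil 1 sigma_gf + (- 48) * dil 2 sigma_gf + 32 * dil 4 sigma_gf"
    unfolding alpha_minus_beta[symmetric] alpha_def beta_def by simp
  have U: "U11 (numeral c * f) = numeral c * U11 f" "U11 (- numeral c * f) = - numeral c * U11 f" for c f
    using U11_of_int_mult[of "numeral c" f] U11_of_int_mult[of "- numeral c" f] by simp_all
  have "coprime (4::nat) 11" using coprime_power_left_iff[of 2 2 "11::nat"] by simp
  show ?thesis
    unfolding v U11_add U
    by (intro rcong_add rcong_mult U11_sigma_gf rcong_refl) (use \<open>coprime 4 11\<close> in simp_all)
qed

text \<open>Since \<open>th_v\<close> is the logarithmic derivative of \<open>t = (th_a / th_b)\<^sup>2\<close>, the monomial is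
  \<open>th_b ^ 110 * t ^ (k - 1) * qD t\<close>, where \<open>th_b ^ 110\<close> is constant for \<open>U11\<close> modulo \<open>11\<close>; this is
  a derivative unless \<open>11\<close> divides \<open>k\<close>.\<close>

lemma U11_monomial:
  assumes "k \<le> 55"
  shows "rcong 11 (U11 ((th_a ^ 2) ^ k * (th_b ^ 2) ^ (55 - k) * th_v))
     (if 11 dvd k then (th_a ^ 2) ^ (k div 11) * (th_b ^ 2) ^ (5 - k div 11) * th_v else 0)"
proof (cases "11 dvd k")
  case True
  then obtain m where m: "k = m * 11" by (metis dvd_def mult.commute)
  define g where "g = (th_a ^ 2) ^ m * (th_b ^ 2) ^ (5 - m)"
  have e: "55 - m * 11 = (5 - m) * 11" by simp
  then have "(th_a ^ 2) ^ k * (th_b ^ 2) ^ (55 - k) * th_v = th_v * g ^ 11"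
    unfolding g_def m e power_mult power_mult_distrib by (simp only: mult_ac)
  also have "rcong 11 \<dots> (th_v * dil 11 g)"
    by (intro rcong_mult rcong_frobenius rcong_refl)
  finally have "rcong 11 (U11 ((th_a ^ 2) ^ k * (th_b ^ 2) ^ (55 - k) * th_v)) (U11 th_v * g)"
    unfolding U11_mult_dil[symmetric] by (rule U11_cong)
  also have "rcong 11 (U11 th_v * g) (th_v * g)" by (intro rcong_mult U11_th_v rcong_refl)
  finally show ?thesis using True by (simp add: m g_def mult_ac)
next
  case False
  define f where "f = (th_a ^ 2) ^ k * (th_b ^ 2) ^ (55 - k)"
  have "logD f (of_nat k * (2 * alpha) + of_nat (55 - k) * (2 * beta))"
    unfolding f_def using logD_power[OF logD_th_a, of 2] logD_power[OF logD_th_b, of 2]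
    by (intro logD_mult logD_power) simp_all
  \<comment> \<open>Substituting \<open>2 beta = 2 alpha - th_v\<close> leaves
    \<open>110 alpha + (k - 55) th_v\<close>, and 11 divides both 110 and 55.\<close>
  also have "of_nat k * (2 * alpha) + of_nat (55 - k) * (2 * beta)
      = of_nat k * th_v + 11 * (10 * alpha - 5 * th_v)"
    unfolding two_beta using assms by (simp add: of_nat_diff algebra_simps)
  finally have "qD f - of_nat k * (f * th_v) = 11 * (f * (10 * alpha - 5 * th_v))"
    by (simp add: logD_def algebra_simps)
  then have "rcong 11 (qD f) (of_int (int k) * (f * th_v))"
    unfolding rcong_def by (metis dvd_triv_left of_int_of_nat_eq)
  then have "rcong 11 (of_int (int k) * U11 (f * th_v)) 0"
    using U11_cong U11_qD unfolding U11_of_int_mult[symmetric] by (metis rcong_sym rcong_trans)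
  then have "11 dvd int k * (f * th_v) $ (11 * n)" for n
    by (simp add: rcong_11_iff fps_of_nat[symmetric] cong_0_iff)
  moreover have "\<not> 11 dvd int k" using False by presburger
  ultimately have "11 dvd (f * th_v) $ (11 * n)" for n
    using prime_dvd_mult_iff[of "11::int"] by simp
  then show ?thesis using False by (simp add: f_def rcong_11_iff cong_0_iff)
qed

subsection \<open>Homogeneous polynomials in the theta series\<close>

text \<open>Moves the expansion to \<open>int poly\<close>, where coefficient lists can be
  multiplied out. Coefficients beyond \<open>n\<close> are lost, hence the degree bounds in the
  product rules.\<close>

definition homog :: "int poly \<Rightarrow> nat \<Rightarrow> int fps \<Rightarrow> int fps \<Rightarrow> int fps" where
  "homog p n x y = (\<Sum>i\<le>n. of_int (coeff p i) * x ^ i * y ^ (n - i))"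

lemma homog_0 [simp]: "homog 0 n x y = 0"
  by (simp add: homog_def)

lemma homog_add: "homog (p + q) n x y = homog p n x y + homog q n x y"
  by (simp add: homog_def sum.distrib algebra_simps)

lemma homog_smult: "homog (smult c p) n x y = of_int c * homog p n x y"
  by (simp add: homog_def sum_distrib_left mult.assoc)

lemma homog_pCons: "homog (pCons c p) (Suc n) x y = of_int c * y ^ Suc n + x * homog p n x y"
  unfolding homog_def by (subst sum.atMost_Suc_shift) (simp add: sum_distrib_left mult_ac)

lemma homog_Suc: "degree p \<le> n \<Longrightarrow> homog p (Suc n) x y = y * homog p n x y"
  by (simp add: homog_def coeff_eq_0 sum_distrib_left Suc_diff_le mult_ac)

lemma homog_add_degree: "degree p \<le> n \<Longrightarrow> homog p (m + n) x y = y ^ m * homog p n x y"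
  by (induction m) (simp_all add: homog_Suc)

lemma homog_mult:
  assumes "degree p \<le> m" "degree q \<le> n"
  shows "homog (p * q) (m + n) x y = homog p m x y * homog q n x y"
  using assms
proof (induction p arbitrary: m rule: pCons_induct)
  case (pCons c p)
  have const: "homog (smult c q) (m + n) x y = of_int c * y ^ m * homog q n x y" for m
    using pCons.prems by (simp add: homog_smult homog_add_degree)
  show ?case
  proof (cases m)
    case 0
    then have "p = 0" using pCons.prems by (simp split: if_splits)
    then show ?thesis using const[of 0] 0 by (simp add: homog_def[of "pCons c 0"])
  next
    case (Suc l)
    have "degree p \<le> l" using pCons.prems Suc by (simp split: if_splits)
    then have "homog (p * q) (l + n) x y = homog p l x y * homog q n x y"
      using pCons.IH pCons.prems by blast
    then show ?thesis
      using const[of "Suc l"] unfolding Suc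
      by (simp add: mult_pCons_left homog_add homog_pCons algebra_simps del: power_Suc)
  qed
qed simp

definition hasse_poly :: "int poly" where
  "hasse_poly = [:1, 25, 100, 100, 25, 1:]"

lemma hasse_poly_2: "hasse_poly * hasse_poly =
  [:1, 50, 825, 5200, 15050, 21252, 15050, 5200, 825, 50, 1:]"
  unfolding hasse_poly_def by simp

lemma hasse_poly_4: "hasse_poly * hasse_poly * (hasse_poly * hasse_poly) =
  [:1, 100, 4150, 92900, 1230725, 10127504, 54027800, 193101200, 472877450, 804867800,
       960098756, 804867800, 472877450, 193101200, 54027800, 10127504, 1230725, 92900, 4150, 100,
       1:]"
  unfolding hasse_poly_2 by simp

definition hasse_poly_8 :: "int poly" where
  "hasse_poly_8 =
  [:1, 200, 18300, 1015800, 38263950, 1037470008, 20978983900, 323918750600, 3884371003725,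
       36665635146400, 275519045132528, 1664377132399200, 8151908899181800, 32610106119096800,
       107204476886929200, 291114303171425056, 655701902488963250, 1229034150707478000,
       1921815356079653000, 2511324376180282000, 2745262470229868820, 2511324376180282000,
       1921815356079653000, 1229034150707478000, 655701902488963250, 291114303171425056,
       107204476886929200, 32610106119096800, 8151908899181800, 1664377132399200,
       275519045132528, 36665635146400, 3884371003725, 323918750600, 20978983900, 1037470008,
       38263950, 1015800, 18300, 200, 1:]"

lemma hasse_poly_8: "hasse_poly ^ 8 = hasse_poly_8"
proof -
  have "hasse_poly ^ 8 = (hasse_poly * hasse_poly * (hasse_poly * hasse_poly))
      * (hasse_poly * hasse_poly * (hasse_poly * hasse_poly))"
    by (simp add: eval_nat_numeral mult_ac)
  then show ?thesis unfolding hasse_poly_4 hasse_poly_8_def by simp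
qed

text \<open>The exponent \<open>8\<close> of \<^term>\<open>hasse_poly\<close> makes the degree \<open>15 + 5 * 8\<close> of the monomials
  multiplying \<^term>\<open>th_v\<close> divisible by \<open>11\<close>, as \<open>U11_monomial\<close> requires.\<close>

definition weight_poly :: "int poly" where
  "weight_poly =
  [:0, 0, 0, 0, 1, 196, 17506, 943796, 34309751, 890436008, 17054642668, 246075595048,
       2710458288643, 22988785169508, 150888034550778, 767081197483188, 3004736470798293,
       8923322771381088, 19293516321168528, 27013773873961056, 12183035547632826, -
       43295441648444664, - 117362567615250524, - 133425450677889944, - 29577598354289930,
       139993478731364720, 224610524096262920, 139993478731364720, - 29577598354289930, -
       133425450677889944, - 117362567615250524, - 43295441648444664, 12183035547632826,
       27013773873961056, 19293516321168528, 8923322771381088, 3004736470798293, 767081197483188,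
       150888034550778, 22988785169508, 2710458288643, 246075595048, 17054642668, 890436008,
       34309751, 943796, 17506, 196, 1:]"

text \<open>The three factors dehomogenise \<open>x^4\<close>, \<open>(x - y)^4\<close> and
  \<open>hasse x y ^ 8\<close> at \<open>y = 1\<close>.\<close>

lemma weight_poly: "[:0, 0, 0, 0, 1:] * [:1, - 4, 6, - 4, 1:] * hasse_poly ^ 8 = weight_poly"
  unfolding hasse_poly_8 hasse_poly_8_def weight_poly_def by simp

lemma homog_hasse_poly: "homog hasse_poly 5 x y = hasse x y"
  by (simp add: hasse_poly_def hasse_def eval_nat_numeral homog_pCons homog_def[of _ 0] algebra_simps)

lemma homog_power: "degree p \<le> n \<Longrightarrow> homog (p ^ k) (k * n) x y = homog p n x y ^ k"
proof (induction k)
  case (Suc k)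
  have "degree (p ^ k) \<le> k * n"
    using degree_power_le[of p k] Suc.prems by (metis mult.commute mult_le_mono2 order_trans)
  then show ?case using homog_mult[of p n "p ^ k" "k * n"] Suc by simp
qed (simp add: homog_def)

lemma homog_weight_poly: "homog weight_poly 48 x y = x ^ 4 * (x - y) ^ 4 * hasse x y ^ 8"
proof -
  have d: "degree hasse_poly \<le> 5" by (simp add: hasse_poly_def)
  then have d8: "degree (hasse_poly ^ 8) \<le> 40" using degree_power_le[of hasse_poly 8] by simp
  have h8: "homog (hasse_poly ^ 8) 40 x y = hasse x y ^ 8"
    using homog_power[OF d, of 8] by (simp add: homog_hasse_poly)
  have 1: "homog [:0, 0, 0, 0, 1:] 4 x y = x ^ 4"
    by (simp add: eval_nat_numeral homog_pCons homog_def[of _ 0])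
  have 2: "homog [:1, - 4, 6, - 4, 1:] 4 x y = (x - y) ^ 4"
    by (simp add: eval_nat_numeral homog_pCons homog_def[of _ 0] algebra_simps)
  have 3: "homog ([:0, 0, 0, 0, 1:] * [:1, - 4, 6, - 4, 1:]) 8 x y = x ^ 4 * (x - y) ^ 4"
    using homog_mult[of "[:0, 0, 0, 0, 1:]" 4 "[:1, - 4, 6, - 4, 1:]" 4 x y] 1 2 by simp
  have d3: "degree ([:0, 0, 0, 0, 1:] * [:1, - 4, 6, - 4, 1:] :: int poly) \<le> 8" by simp
  show ?thesis
    using homog_mult[OF d3 d8, of x y] h8 3 unfolding weight_poly by simp
qed

text \<open>The indices are \<open>11 m - 1\<close>: a factor \<open>x\<close> kept outside raises
  these exponents to multiples of 11.\<close>

lemma coeff_weight_poly: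
  "[coeff weight_poly 10 = 8] (mod 11)" "[coeff weight_poly 21 = - 8] (mod 11)"
  "[coeff weight_poly 32 = 8] (mod 11)" "[coeff weight_poly 43 = 0] (mod 11)"
  unfolding weight_poly_def by (simp_all add: numeral_eq_Suc coeff_pCons_Suc cong_def)

subsection \<open>Broken 5-diamond partitions\<close>

lemma U11_theta_form:
  "rcong 11 (U11 ((th_a ^ 2) ^ 5 * (th_b ^ 2) ^ 6 * th_v ^ 5))
     (8 * (th_a ^ 2 * (th_b ^ 2) ^ 2 * th_v * dil 2 eisenstein_E4))"
proof -
  define x y where "x = th_a ^ 2" and "y = th_b ^ 2"
  define c where "c = coeff weight_poly"
  have "rcong 11 (x ^ 5 * y ^ 6 * th_v ^ 5 * hasse x y ^ 8) (x ^ 5 * y ^ 6 * th_v ^ 5 * (- 1) ^ 8)"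
    unfolding x_def y_def by (intro rcong_mult rcong_power hasse_cong rcong_refl)
  then have "rcong 11 (x ^ 5 * y ^ 6 * th_v ^ 5) (x ^ 5 * y ^ 6 * th_v ^ 5 * hasse x y ^ 8)"
    by (simp add: rcong_sym)
  \<comment> \<open>One \<open>th_v\<close> stays outside for \<open>U11_monomial\<close>, with
    \<open>x y^6\<close>; the other four become \<open>(x - y)^4\<close>.\<close>
  also have "x ^ 5 * y ^ 6 * th_v ^ 5 * hasse x y ^ 8
      = x * y ^ 6 * th_v * (x ^ 4 * (x - y) ^ 4 * hasse x y ^ 8)"
  proof -
    have v: "th_v = x - y" by (simp add: th_v_def x_def y_def)
    show ?thesis unfolding v by (simp add: eval_nat_numeral mult_ac)
  qed
  also have "\<dots> = (\<Sum>i\<le>48. of_int (c i) * (x ^ Suc i * y ^ (55 - Suc i) * th_v))"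
    unfolding homog_weight_poly[symmetric] homog_def sum_distrib_left c_def
  proof (intro sum.cong refl)
    fix i :: nat assume "i \<in> {..48}"
    then have "55 - Suc i = 6 + (48 - i)" by auto
    then have "y ^ (55 - Suc i) = y ^ 6 * y ^ (48 - i)" by (simp only: power_add)
    then show "x * y ^ 6 * th_v * (of_int (coeff weight_poly i) * x ^ i * y ^ (48 - i))
        = of_int (coeff weight_poly i) * (x ^ Suc i * y ^ (55 - Suc i) * th_v)"
      by (simp add: mult_ac)
  qed
  finally have "rcong 11 (U11 (x ^ 5 * y ^ 6 * th_v ^ 5))
      (\<Sum>i\<le>48. of_int (c i) * U11 (x ^ Suc i * y ^ (55 - Suc i) * th_v))"
    unfolding U11_of_int_mult[symmetric] U11_sum[symmetric] by (rule U11_cong)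
  also have "rcong 11 \<dots> (\<Sum>i\<le>48. of_int (c i) * (if 11 dvd Suc i
      then x ^ (Suc i div 11) * y ^ (5 - Suc i div 11) * th_v else 0))"
    unfolding x_def y_def by (intro rcong_sum rcong_mult rcong_refl U11_monomial) simp
  also have "\<dots> = (\<Sum>i\<in>{10, 21, 32, 43}. of_int (c i)
      * (x ^ (Suc i div 11) * y ^ (5 - Suc i div 11) * th_v))"
  proof (rule sum.mono_neutral_cong_right)
    show "\<forall>i\<in>{..48} - {10, 21, 32, 43}. of_int (c i) * (if 11 dvd Suc i
      then x ^ (Suc i div 11) * y ^ (5 - Suc i div 11) * th_v else 0) = 0"
    proof
      fix i :: nat assume "i \<in> {..48} - {10, 21, 32, 43}"
      then have "\<not> 11 dvd Suc i" by simp presburger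
      then show "of_int (c i) * (if 11 dvd Suc i
        then x ^ (Suc i div 11) * y ^ (5 - Suc i div 11) * th_v else 0) = 0" by simp
    qed
  qed auto
  also have "\<dots> = of_int (c 10) * (x ^ 1 * y ^ 4 * th_v) + of_int (c 21) * (x ^ 2 * y ^ 3 * th_v)
      + of_int (c 32) * (x ^ 3 * y ^ 2 * th_v) + of_int (c 43) * (x ^ 4 * y ^ 1 * th_v)"
    by simp
  also have "rcong 11 \<dots> (of_int 8 * (x ^ 1 * y ^ 4 * th_v) + of_int (- 8) * (x ^ 2 * y ^ 3 * th_v)
      + of_int 8 * (x ^ 3 * y ^ 2 * th_v) + of_int 0 * (x ^ 4 * y ^ 1 * th_v))"
  proof -
    have of_int: "rcong 11 (of_int a) (of_int b :: int fps)" if "[a = b] (mod 11)" for a b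
      using that by (simp add: rcong_11_iff fps_of_int[symmetric])
    show ?thesis unfolding c_def
      by (intro rcong_add rcong_mult rcong_refl of_int coeff_weight_poly)
  qed
  also have "\<dots> = 8 * (x * y ^ 2 * th_v * dil 2 eisenstein_E4)"
  proof -
    have E4: "dil 2 eisenstein_E4 = x ^ 2 - x * y + y ^ 2"
      unfolding dil_eisenstein_E4 x_def y_def by (simp flip: power_mult)
    show ?thesis unfolding E4 by (simp add: eval_nat_numeral algebra_simps)
  qed
  finally show ?thesis unfolding x_def y_def .
qed

text \<open>\<open>K\<close> collects the denominators of the three eta quotients and cancels at the
  end. The exponents 10, 12 and 5 make \<open>dil 4 euler\<close> disappear.\<close>

lemma theta_form_eta:
  "(th_a ^ 2) ^ 5 * (th_b ^ 2) ^ 6 * th_v ^ 5 = (16 * fps_X) ^ 5 * euler ^ 8 * dil 2 euler ^ 56"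
proof -
  let ?e = euler and ?e2 = "dil 2 euler" and ?e4 = "dil 4 euler"
  define K where "K = (?e ^ 4 * ?e4 ^ 4) ^ 10 * (?e2 ^ 2) ^ 12 * (?e2 ^ 4) ^ 5"
  have "K \<noteq> 0" by (simp add: K_def)
  have "(th_a ^ 2) ^ 5 * (th_b ^ 2) ^ 6 * th_v ^ 5 * K
      = (th_a * (?e ^ 4 * ?e4 ^ 4)) ^ 10 * (th_b * ?e2 ^ 2) ^ 12 * (th_v * ?e2 ^ 4) ^ 5"
    unfolding K_def by (simp add: power_mult_distrib mult_ac flip: power_mult power_add)
  also have "\<dots> = (16 * fps_X) ^ 5 * euler ^ 8 * dil 2 euler ^ 56 * K"
    unfolding th_a_eta th_b_eta th_v_eta K_def
    by (simp add: power_mult_distrib mult_ac flip: power_mult power_add)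
  finally show ?thesis using \<open>K \<noteq> 0\<close> by simp
qed

lemma theta_form_image_eta:
  "th_a ^ 2 * (th_b ^ 2) ^ 2 * th_v = 16 * fps_X * euler ^ 8 * dil 2 euler ^ 8"
proof -
  let ?e = euler and ?e2 = "dil 2 euler" and ?e4 = "dil 4 euler"
  define K where "K = (?e ^ 4 * ?e4 ^ 4) ^ 2 * (?e2 ^ 2) ^ 4 * ?e2 ^ 4"
  have "K \<noteq> 0" by (simp add: K_def)
  have "th_a ^ 2 * (th_b ^ 2) ^ 2 * th_v * K
      = (th_a * (?e ^ 4 * ?e4 ^ 4)) ^ 2 * (th_b * ?e2 ^ 2) ^ 4 * (th_v * ?e2 ^ 4)"
    unfolding K_def by (simp add: power_mult_distrib mult_ac flip: power_mult power_add)
  also have "\<dots> = 16 * fps_X * euler ^ 8 * dil 2 euler ^ 8 * K"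
    unfolding th_a_eta th_b_eta th_v_eta K_def
    by (simp add: power_mult_distrib mult_ac flip: power_mult power_add)
  finally show ?thesis using \<open>K \<noteq> 0\<close> by simp
qed

lemma prodinf_fps_eqI:
  fixes f :: "nat \<Rightarrow> int fps"
  assumes "\<And>n. fps_cutoff (Suc n) (f n) = 1" "\<And>m. rcong (fps_X ^ Suc m) (\<Prod>i\<le>m. f i) g"
  shows "prodinf f = g"
proof -
  have "(\<lambda>m. \<Prod>i\<le>m. f i) \<longlonglongrightarrow> g"
  proof (rule tendsto_fpsI)
    fix j
    show "eventually (\<lambda>m. (\<Prod>i\<le>m. f i) $ j = g $ j) sequentially"
      using eventually_ge_at_top[of j]
    proof eventually_elim
      case (elim m)
      then show ?case using assms(2)[of m] by (simp add: rcong_fps_X_iff del: power_Suc)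
    qed
  qed
  then show ?thesis using fps_has_prod_prodinf(1)[OF assms(1)] LIMSEQ_unique by blast
qed

lemma rcong_partial_euler:
  assumes "k > 0"
  shows "rcong (fps_X ^ Suc m) (\<Prod>i\<le>m. 1 - fps_X ^ (k * Suc i)) (dil k euler)"
proof -
  have "(\<Prod>i\<le>m. 1 - fps_X ^ (k * Suc i)) = (q_fact (fps_X ^ k) (Suc m) :: int fps)"
    unfolding q_fact_def lessThan_Suc_atMost power_mult ..
  moreover have "Suc m \<le> k * Suc (Suc m)" using assms by (cases k) auto
  ultimately show ?thesis
    using rcong_dvd[OF le_imp_power_dvd rcong_dil_euler[OF assms, of "Suc m"]] rcong_sym by metis
qed

lemma prodinf_eta_8_2:
  "(\<Prod>n. (1 - fps_X ^ Suc n) ^ 8 * (1 - fps_X ^ (2 * Suc n)) ^ 2) = euler ^ 8 * dil 2 euler ^ 2"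
proof (rule prodinf_fps_eqI)
  fix n
  show "fps_cutoff (Suc n) ((1 - fps_X ^ Suc n) ^ 8 * (1 - fps_X ^ (2 * Suc n)) ^ 2 :: int fps) = 1"
    using fps_cutoff_one_minus_X_power[of 1]
    by (intro fps_cutoff_mult_eq_1 fps_cutoff_power_eq_1 fps_cutoff_one_minus_X_power) simp_all
next
  fix m
  show "rcong (fps_X ^ Suc m) (\<Prod>i\<le>m. (1 - fps_X ^ Suc i) ^ 8 * (1 - fps_X ^ (2 * Suc i)) ^ 2)
     (euler ^ 8 * dil 2 euler ^ 2)"
    unfolding prod.distrib prod_power_distrib[symmetric]
    using rcong_partial_euler[of 1 m]
    by (intro rcong_mult rcong_power rcong_partial_euler) (simp_all del: power_Suc)
qed

text \<open>The generating function with denominators cleared. The candidate limit \<open>G\<close>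
  is verified by multiplying the partial products by their denominators, which removes the
  factorwise reciprocals.\<close>

lemma broken_diamond_gf_5_euler:
  "broken_diamond_gf 5 * (euler ^ 3 * dil 22 euler) = dil 2 euler * dil 11 euler"
proof -
  let ?d = "\<lambda>n. (1 - fps_X ^ Suc n) ^ 3 * (1 - fps_X ^ (22 * Suc n)) :: int fps"
  let ?f = "\<lambda>n. (1 - fps_X ^ (2 * Suc n)) * (1 - fps_X ^ (11 * Suc n)) * fps_right_inverse (?d n) 1"
  let ?D = "euler ^ 3 * dil 22 euler"
  have inv: "g * fps_right_inverse g 1 = 1" if "g $ 0 = 1" for g :: "int fps"
    by (rule fps_right_inverse) (simp add: that)
  have D0: "?D $ 0 = 1" by (simp add: fps_nth_power_0)
  have d0: "?d n $ 0 = 1" for n by (simp add: fps_nth_power_0)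
  define G where "G = dil 2 euler * dil 11 euler * fps_right_inverse ?D 1"
  have G: "?D * G = dil 2 euler * dil 11 euler"
  proof -
    have "?D * G = (?D * fps_right_inverse ?D 1) * (dil 2 euler * dil 11 euler)"
      unfolding G_def by (simp only: mult_ac)
    then show ?thesis unfolding inv[OF D0] by simp
  qed
  have "prodinf ?f = G"
  proof (rule prodinf_fps_eqI)
    fix n
    show "fps_cutoff (Suc n) (?f n) = 1"
      using fps_cutoff_one_minus_X_power[of 1]
      by (intro fps_cutoff_mult_eq_1 fps_cutoff_power_eq_1 fps_cutoff_right_inverse_eq_1
          fps_cutoff_one_minus_X_power) simp_all
  next
    fix m
    let ?h = "fps_X ^ Suc m :: int fps"
    have D: "rcong ?h (\<Prod>i\<le>m. ?d i) ?D"
      unfolding prod.distrib prod_power_distrib[symmetric]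
      using rcong_partial_euler[of 1 m]
      by (intro rcong_mult rcong_power rcong_partial_euler) (simp_all del: power_Suc)
    have "?d i * ?f i = (1 - fps_X ^ (2 * Suc i)) * (1 - fps_X ^ (11 * Suc i))" for i
    proof -
      have "?d i * ?f i = (1 - fps_X ^ (2 * Suc i)) * (1 - fps_X ^ (11 * Suc i))
          * (?d i * fps_right_inverse (?d i) 1)"
        by (simp only: mult_ac)
      then show ?thesis unfolding inv[OF d0] by simp
    qed
    then have df: "(\<Prod>i\<le>m. ?d i) * (\<Prod>i\<le>m. ?f i)
        = (\<Prod>i\<le>m. 1 - fps_X ^ (2 * Suc i)) * (\<Prod>i\<le>m. 1 - fps_X ^ (11 * Suc i))"
      unfolding prod.distrib[symmetric] by (intro prod.cong refl)
    have "rcong ?h (?D * (\<Prod>i\<le>m. ?f i)) ((\<Prod>i\<le>m. ?d i) * (\<Prod>i\<le>m. ?f i))"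
      by (intro rcong_mult rcong_refl rcong_sym[OF D])
    also have "rcong ?h \<dots> (dil 2 euler * dil 11 euler)"
      unfolding df by (intro rcong_mult rcong_partial_euler) simp_all
    finally have "rcong ?h (?D * (\<Prod>i\<le>m. ?f i)) (?D * G)" unfolding G .
    then show "rcong ?h (\<Prod>i\<le>m. ?f i) G" by (rule rcong_fps_X_cancel) (simp add: D0)
  qed
  moreover have "broken_diamond_gf 5 = prodinf ?f" unfolding broken_diamond_gf_def by simp
  ultimately show ?thesis using G by (simp add: mult.commute)
qed

text \<open>By Frobenius the factors in \<open>q^11\<close> and \<open>q^22\<close> become eleventh
  powers, leaving \<open>euler ^ 8\<close> over \<open>dil 2 euler ^ 10\<close>.\<close>

lemma broken_diamond_gf_5_cong: "rcong 11 (broken_diamond_gf 5 * dil 2 euler ^ 10) (euler ^ 8)"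
proof -
  let ?D = "broken_diamond_gf 5" and ?e = euler and ?e2 = "dil 2 euler"
  have "rcong 11 (?D * (?e ^ 3 * ?e2 ^ 11)) (?D * (?e ^ 3 * dil 11 ?e2))"
    by (intro rcong_mult rcong_refl rcong_frobenius)
  also have "\<dots> = ?e2 * dil 11 ?e"
    using broken_diamond_gf_5_euler by (simp add: dil_dil)
  also have "rcong 11 \<dots> (?e2 * ?e ^ 11)"
    by (intro rcong_mult rcong_refl rcong_sym[OF rcong_frobenius])
  finally have "rcong 11 (?D * (?e ^ 3 * ?e2 ^ 11)) (?e2 * ?e ^ 11)" .
  also have "?D * (?e ^ 3 * ?e2 ^ 11) = (?e ^ 3 * ?e2) * (?D * ?e2 ^ 10)"
    by (simp add: eval_nat_numeral mult_ac)
  also have "?e2 * ?e ^ 11 = (?e ^ 3 * ?e2) * ?e ^ 8"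
    by (simp add: eval_nat_numeral mult_ac)
  finally have "rcong (of_int 11) ((?e ^ 3 * ?e2) * (?D * ?e2 ^ 10)) ((?e ^ 3 * ?e2) * ?e ^ 8)"
    by simp
  then have "rcong (of_int 11) (?D * ?e2 ^ 10) (?e ^ 8)"
    by (rule rcong_int_cancel) (simp add: fps_nth_power_0)
  then show ?thesis by simp
qed

text \<open>The factor \<open>q^5\<close> moves index \<open>11 n + 6\<close> to
  \<open>11 (n + 1)\<close>; the constant term is 0.\<close>

lemma U11_broken_diamond:
  "U11 (fps_X ^ 5 * broken_diamond_gf 5) = fps_X * Abs_fps (\<lambda>n. broken_diamond 5 (11 * n + 6))"
proof (rule fps_ext)
  fix n
  show "U11 (fps_X ^ 5 * broken_diamond_gf 5) $ n
      = (fps_X * Abs_fps (\<lambda>n. broken_diamond 5 (11 * n + 6))) $ n"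
    by (cases n) (simp_all add: fps_X_power_mult_nth broken_diamond_def add.commute)
qed

lemma rcong_11_X_cancel:
  assumes "rcong 11 (fps_X * f) (fps_X * (g :: int fps))"
  shows "rcong 11 f g"
  unfolding rcong_11_iff
proof
  fix n
  have "[(fps_X * f) $ Suc n = (fps_X * g) $ Suc n] (mod 11)"
    using assms unfolding rcong_11_iff by blast
  then show "[f $ n = g $ n] (mod 11)" by simp
qed

theorem theorem1p2:
  shows "fps_cong
           ((eisenstein_E4 oo fps_X ^ 2) *
              (\<Prod>n. (1 - fps_X ^ Suc n) ^ 8 * (1 - fps_X ^ (2 * Suc n)) ^ 2))
           (8 * Abs_fps (\<lambda>n. broken_diamond 5 (11 * n + 6)))
           11"
proof -
  let ?D = "broken_diamond_gf 5" and ?e = euler and ?e2 = "dil 2 euler" and ?E = "dil 2 eisenstein_E4"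
  define R where "R = Abs_fps (\<lambda>n. broken_diamond 5 (11 * n + 6))"
  \<comment> \<open>The factor in \<open>q^11\<close> passes through \<open>U11\<close>, and by
    Frobenius it changes the exponent of \<open>dil 2 euler\<close> from -10 to 56, as in
    \<open>theta_form_eta\<close>.\<close>
  have "rcong 11 (fps_X ^ 5 * ?D * dil 11 (?e2 ^ 6)) (fps_X ^ 5 * ?D * (?e2 ^ 6) ^ 11)"
    by (intro rcong_mult rcong_refl rcong_sym[OF rcong_frobenius])
  also have "\<dots> = fps_X ^ 5 * (?D * ?e2 ^ 10) * ?e2 ^ 56"
    by (simp add: mult_ac flip: power_mult power_add)
  also have "rcong 11 \<dots> (fps_X ^ 5 * ?e ^ 8 * ?e2 ^ 56)"
    by (intro rcong_mult rcong_refl broken_diamond_gf_5_cong)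
  \<comment> \<open>\<open>16^5\<close> is 1 modulo 11; it supplies the constant in
    \<open>theta_form_eta\<close>.\<close>
  also have "rcong 11 \<dots> (16 ^ 5 * (fps_X ^ 5 * ?e ^ 8 * ?e2 ^ 56))"
  proof -
    have "16 ^ 5 * f - f = 11 * (95325 * f)" for f :: "int fps" by simp
    then show ?thesis using rcong_sym unfolding rcong_def by (metis dvd_triv_left)
  qed
  also have "\<dots> = (th_a ^ 2) ^ 5 * (th_b ^ 2) ^ 6 * th_v ^ 5"
    unfolding theta_form_eta by (simp only: power_mult_distrib mult_ac)
  finally have "rcong 11 (U11 (fps_X ^ 5 * ?D) * ?e2 ^ 6)
      (U11 ((th_a ^ 2) ^ 5 * (th_b ^ 2) ^ 6 * th_v ^ 5))"
    unfolding U11_mult_dil[symmetric] by (rule U11_cong)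
  also have "rcong 11 \<dots> (8 * (th_a ^ 2 * (th_b ^ 2) ^ 2 * th_v * ?E))"
    by (rule U11_theta_form)
  finally have "rcong 11 (fps_X * (R * ?e2 ^ 6)) (fps_X * (128 * ?E * ?e ^ 8 * ?e2 ^ 8))"
    unfolding theta_form_image_eta U11_broken_diamond R_def[symmetric] by (simp add: mult_ac)
  then have "rcong 11 (R * ?e2 ^ 6) (128 * ?E * ?e ^ 8 * ?e2 ^ 8)"
    by (rule rcong_11_X_cancel)
  then have "rcong (of_int 11) (?e2 ^ 6 * R) (?e2 ^ 6 * (128 * ?E * ?e ^ 8 * ?e2 ^ 2))"
    by (simp add: mult_ac flip: power_add)
  then have "rcong (of_int 11) R (128 * ?E * ?e ^ 8 * ?e2 ^ 2)"
    by (rule rcong_int_cancel) (simp add: fps_nth_power_0)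
  \<comment> \<open>The constant is \<open>128 = 8 * 16\<close>, and \<open>8 * 128 = 1024\<close>
    is 1 modulo 11.\<close>
  then have "rcong 11 (8 * R) (8 * (128 * ?E * ?e ^ 8 * ?e2 ^ 2))"
    by (intro rcong_mult rcong_refl) simp
  also have "rcong 11 \<dots> (?E * (?e ^ 8 * ?e2 ^ 2))"
  proof -
    have "8 * (128 * ?E * ?e ^ 8 * ?e2 ^ 2) - ?E * (?e ^ 8 * ?e2 ^ 2)
        = 11 * (93 * (?E * (?e ^ 8 * ?e2 ^ 2)))" by (simp add: mult.assoc)
    then show ?thesis unfolding rcong_def by (metis dvd_triv_left)
  qed
  finally show ?thesis
    unfolding fps_cong_iff_rcong prodinf_eta_8_2 R_def by (simp add: rcong_sym)
qed

end
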